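(* Let $G=(V,E)$ be a finite quiver without self-loops, with $V=\{1,\dots,p\}$, let $n_v\ge1$ be integers for $v\in V$, let $x_e\ge0$ be real numbers for $e\in E$, let $\kappa_a\ge0$ be real numbers for $a\in V$, and let $(U_e)_{e\in E}$ be complex matrices, $U_e$ of size $n_{s(e)}\times n_{t(e)}$. Let $\Delta$ be the associated twisted Laplacian. Assume that: (i) for each $a\in V$ there exist $b\in V$ with $\kappa_b>0$ and a (possibly empty) directed path in $G$ from $a$ to $b$ along edges $e$ with $x_e>0$; (ii) there are norms on the spaces $\mathbb{C}^{n_v}$, $v\in V$, such that for every $e\in E$ the operator norm of $U_e:\mathbb{C}^{n_{t(e)}}\to\mathbb{C}^{n_{s(e)}}$ satisfies $\|U_e\|\le1$. For $e\in E$ set $p_e=\dfrac{x_e}{z_{s(e)}+\kappa_{s(e)}}$. Then $$\det\big(\operatorname{diag}(\kappa_aI_{n_a}:a\in V)+\Delta\big)=(\underline{z}+\underline{\kappa})^{\underline{n}}\prod_{\mathsf{c}\in\mathcal{P}(G)}\det\big(I-\underline{p}^{\underline{e}(\mathsf{c})}\operatorname{hol}(\mathsf{c})\big).$$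
   Context: A finite quiver is a finite directed graph (multiple edges allowed); each edge $e$ goes from $s(e)$ to $t(e)$, and no self-loops means $s(e)\ne t(e)$ for all $e$. The twisted Laplacian is the endomorphism of $\bigoplus_{v\in V}\mathbb{C}^{n_v}$ given by $\Delta f(v)=\sum_{e\in E:\,s(e)=v}x_e\,[f(s(e))-U_ef(t(e))]$. For $a\in V$, $z_a=\sum_{e\in E:\,s(e)=a}x_e$, and $(\underline{z}+\underline{\kappa})^{\underline{n}}=\prod_{a\in V}(z_a+\kappa_a)^{n_a}$. A cycle $\mathsf{c}$ on $G$ is a sequence of edges $(e_1,\dots,e_k)$, $k\ge 1$, with $t(e_i)=s(e_{i+1})$ for $1\le i<k$ and $t(e_k)=s(e_1)$, considered up to cyclic permutation (vertices and edges may be repeated). Its valuation is the order of the stabiliser of $(e_1,\dots,e_k)$ under the cyclic shift action of $\mathbb{Z}/k\mathbb{Z}$; $\mathcal{P}(G)$ is the set of prime cycles, i.e. cycles on $G$ of valuation $1$ (not necessarily simple). $\underline{p}^{\underline{e}(\mathsf{c})}=p_{e_1}\cdots p_{e_k}$, and $\operatorname{hol}(\mathsf{c})=U_{e_1}\cdots U_{e_k}\in M_{n_{s(e_1)}}(\mathbb{C})$; this matrix depends on the starting point but $\det(I-\underline{p}^{\underline{e}(\mathsf{c})}\operatorname{hol}(\mathsf{c}))$ (with $I=I_{n_{s(e_1)}}$) does not. The (countable, possibly infinite) product is understood as an absolutely convergent product of complex numbers. *)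

theory Defs
  imports
    "HOL-Analysis.Infinite_Sum"
    "HOL-Library.Extended_Real"
    "Graph_Theory.Digraph"
    "Graph_Theory.Arc_Walk"
    "Jordan_Normal_Form.Matrix"
    "Jordan_Normal_Form.Determinant"
begin

text \<open>
  A quiver is a \<open>pre_digraph\<close> satisfying \<open>fin_digraph\<close> (parallel arcs are allowed); \<open>s(e)\<close> is
  \<open>tail G e\<close> and \<open>t(e)\<close> is \<open>head G e\<close>.
\<close>

definition out_weight :: "('v, 'e) pre_digraph \<Rightarrow> ('e \<Rightarrow> real) \<Rightarrow> 'v \<Rightarrow> real" where
  "out_weight G x a = (\<Sum>e\<in>{e \<in> arcs G. tail G e = a}. x e)"

text \<open>
  An element of the direct sum of the spaces \<open>\<complex>\<^bsup>n v\<^esup>\<close> is a function \<open>f\<close> with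
  \<open>f v \<in> carrier_vec (n v)\<close> for every vertex \<open>v\<close>.
\<close>

definition twisted_laplacian ::
  "('v, 'e) pre_digraph \<Rightarrow> ('v \<Rightarrow> nat) \<Rightarrow> ('e \<Rightarrow> real) \<Rightarrow> ('e \<Rightarrow> complex mat)
    \<Rightarrow> ('v \<Rightarrow> complex vec) \<Rightarrow> 'v \<Rightarrow> complex vec" where
  "twisted_laplacian G n x U f v =
     finsum_vec TYPE(complex) (n v)
       (\<lambda>e. complex_of_real (x e) \<cdot>\<^sub>v (f (tail G e) - U e *\<^sub>v f (head G e)))
       {e \<in> arcs G. tail G e = v}"

text \<open>
  For the vertex set \<open>{1..p}\<close>, the direct sum is identified with \<open>\<complex>\<^sup>N\<close>, \<open>N = n 1 + \<dots> + n p\<close>, by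
  concatenating the components in the order of the vertices: \<open>flatten\<close> is this isomorphism,
  \<open>unflatten\<close> its inverse, and \<open>endo_mat n p T\<close> is the matrix of the endomorphism \<open>T\<close> in the
  resulting standard basis.
\<close>

definition flatten :: "nat \<Rightarrow> (nat \<Rightarrow> complex vec) \<Rightarrow> complex vec" where
  "flatten p f = foldr (\<lambda>v w. f v @\<^sub>v w) [1..<Suc p] vNil"

definition unflatten :: "(nat \<Rightarrow> nat) \<Rightarrow> complex vec \<Rightarrow> nat \<Rightarrow> complex vec" where
  "unflatten n w v = vec (n v) (\<lambda>i. w $ ((\<Sum>u\<in>{1..<v}. n u) + i))"

definition endo_mat ::
  "(nat \<Rightarrow> nat) \<Rightarrow> nat \<Rightarrow> ((nat \<Rightarrow> complex vec) \<Rightarrow> nat \<Rightarrow> complex vec) \<Rightarrow> complex mat" where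
  "endo_mat n p T = (let N = \<Sum>v\<in>{1..p}. n v in
     mat_of_cols N (map (\<lambda>j. flatten p (T (unflatten n (unit_vec N j)))) [0..<N]))"

definition vec_norm_on :: "nat \<Rightarrow> (complex vec \<Rightarrow> real) \<Rightarrow> bool" where
  "vec_norm_on m N \<longleftrightarrow>
     (\<forall>u\<in>carrier_vec m. N u \<ge> 0 \<and> (N u = 0 \<longleftrightarrow> u = 0\<^sub>v m)) \<and>
     (\<forall>c. \<forall>u\<in>carrier_vec m. N (c \<cdot>\<^sub>v u) = cmod c * N u) \<and>
     (\<forall>u\<in>carrier_vec m. \<forall>w\<in>carrier_vec m. N (u + w) \<le> N u + N w)"

text \<open>
  The operator norm of \<open>A : (\<complex>\<^sup>m, N) \<rightarrow> (\<complex>\<^sup>k, N')\<close>. The supremum is taken in \<open>ereal\<close> because \<open>Sup\<close> on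
  \<open>real\<close> is unspecified for sets not known to be bounded.
\<close>

definition op_norm ::
  "nat \<Rightarrow> (complex vec \<Rightarrow> real) \<Rightarrow> (complex vec \<Rightarrow> real) \<Rightarrow> complex mat \<Rightarrow> ereal" where
  "op_norm m N N' A = (SUP u\<in>{u \<in> carrier_vec m. N u \<le> 1}. ereal (N' (A *\<^sub>v u)))"

definition trans_prob ::
  "('v, 'e) pre_digraph \<Rightarrow> ('e \<Rightarrow> real) \<Rightarrow> ('v \<Rightarrow> real) \<Rightarrow> 'e \<Rightarrow> real" where
  "trans_prob G x \<kappa> e = x e / (out_weight G x (tail G e) + \<kappa> (tail G e))"

definition closed_seqs :: "('v, 'e) pre_digraph \<Rightarrow> 'e list set" where
  "closed_seqs G = {es. es \<noteq> [] \<and> set es \<subseteq> arcs G \<and>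
     (\<forall>i < length es. head G (es ! i) = tail G (es ! ((i + 1) mod length es)))}"

definition cyclic_perm :: "('e list \<times> 'e list) set" where
  "cyclic_perm = {(es, fs). \<exists>m. fs = rotate m es}"

definition quiver_cycles :: "('v, 'e) pre_digraph \<Rightarrow> 'e list set set" where
  "quiver_cycles G = closed_seqs G // cyclic_perm"

text \<open>
  Valuation and determinant factor of a cycle are read off an arbitrarily chosen representative;
  neither depends on this choice.
\<close>

definition cycle_rep :: "'e list set \<Rightarrow> 'e list" where
  "cycle_rep c = (SOME es. es \<in> c)"

definition valuation :: "'e list set \<Rightarrow> nat" where
  "valuation c = card {m \<in> {..<length (cycle_rep c)}. rotate m (cycle_rep c) = cycle_rep c}"

definition prime_cycles :: "('v, 'e) pre_digraph \<Rightarrow> 'e list set set" where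
  "prime_cycles G = {c \<in> quiver_cycles G. valuation c = 1}"

definition hol ::
  "('v, 'e) pre_digraph \<Rightarrow> ('v \<Rightarrow> nat) \<Rightarrow> ('e \<Rightarrow> complex mat) \<Rightarrow> 'e list \<Rightarrow> complex mat" where
  "hol G n U es = foldr (\<lambda>e A. U e * A) es (1\<^sub>m (n (head G (last es))))"

definition cycle_factor ::
  "('v, 'e) pre_digraph \<Rightarrow> ('v \<Rightarrow> nat) \<Rightarrow> ('e \<Rightarrow> real) \<Rightarrow> ('e \<Rightarrow> complex mat)
    \<Rightarrow> 'e list set \<Rightarrow> complex" where
  "cycle_factor G n q U c = (let es = cycle_rep c in
     det (1\<^sub>m (n (tail G (hd es))) - complex_of_real (\<Prod>e\<leftarrow>es. q e) \<cdot>\<^sub>m hol G n U es))"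

text \<open>
  The library has infinite products only for sequences. For a product over a set, absolute
  convergence is absolute summability of \<open>f - 1\<close>, and the value is the limit of the finite partial
  products; as for \<open>infsum\<close>, the value is meaningful only together with convergence.
\<close>

definition abs_convergent_prod_on :: "('i \<Rightarrow> complex) \<Rightarrow> 'i set \<Rightarrow> bool" where
  "abs_convergent_prod_on f A \<longleftrightarrow> (\<lambda>i. f i - 1) abs_summable_on A"

definition infprod :: "('i \<Rightarrow> complex) \<Rightarrow> 'i set \<Rightarrow> complex" where
  "infprod f A = Lim (finite_subsets_at_top A) (\<lambda>F. \<Prod>i\<in>F. f i)"

end

theory Submission
  imports
    "HOL-Analysis.Complex_Transcendental"
    "Jordan_Normal_Form.Schur_Decomposition"
    Defs
begin

text \<open>
  Let \<open>q e\<close> be the transition probability of the arc \<open>e\<close>, and let \<open>A\<close> be the block matrix whose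
  \<open>(v, w)\<close> block is the sum of \<open>q e \<cdot> U e\<close> over the arcs \<open>e\<close> from \<open>v\<close> to \<open>w\<close>. The matrix of
  \<open>diag(\<kappa>) + \<Delta>\<close> is \<open>diag(z + \<kappa>) \<cdot> (1 - A)\<close> (\<open>laplacian_matrix\<close>), so the theorem amounts to an
  Euler product for \<open>det (1 - A)\<close>.

  For every matrix \<open>B\<close> whose eigenvalues lie in the open unit disc,
  \<open>det (1 - B) = exp (- \<Sum>\<^sub>k tr (B\<^sup>k) / k)\<close>, where \<open>k\<close> runs over the positive integers
  (\<open>det_one_minus_eq_exp_traces\<close>). The trace of \<open>A\<^sup>k\<close> is the sum of \<open>F w = q(w) tr (hol w)\<close> over
  the closed walks \<open>w\<close> of length \<open>k\<close>, where \<open>q(w)\<close> is the product of the weights along \<open>w\<close>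
  (\<open>mat_trace_transfer_mat_pow\<close>). Hence the logarithm of \<open>det (1 - A)\<close> is minus the sum of
  \<open>F w / |w|\<close> over all closed walks. Every nonempty word is in exactly one way a power \<open>u\<^sup>k\<close> of a
  primitive word \<open>u\<close>, and a primitive word of length \<open>l\<close> has \<open>l\<close> distinct rotations, which share
  the same values \<open>F (u\<^sup>k)\<close>. The \<open>l\<close> rotations cancel the factor \<open>l\<close> of \<open>|u\<^sup>k| = k l\<close>, and the sum
  becomes the sum of \<open>tr ((q(c) hol(c))\<^sup>k) / k\<close> over the prime cycles \<open>c\<close> and over \<open>k\<close>
  (\<open>sum_over_words_eq_sum_over_primitive_classes\<close>). For fixed \<open>c\<close> this is again minus the logarithm
  of a determinant, namely of the factor belonging to \<open>c\<close>.

  Absolute convergence is obtained from eigenvalues. Since the \<open>U e\<close> are contractions, the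
  eigenvalues of \<open>q(w) hol(w)\<close> have modulus at most \<open>q(w)\<close>, so \<open>|F w|\<close> is at most \<open>q(w)\<close> times the
  size of \<open>A\<close>. The eigenvalues of \<open>A\<close> have modulus less than \<open>1\<close> by a maximum principle: otherwise
  the norms of the components of an eigenvector would form a subharmonic function for the
  substochastic weights \<open>q\<close>, and such a function vanishes because every vertex is connected to one
  where mass is lost (\<open>subharmonic_eq_0\<close>). Finally, the weights \<open>q(w)\<close> of the closed walks are
  summable: by the trace formula for one-dimensional fibres and trivial \<open>U\<close>, their sum is the sum of
  the traces of the positive powers of the matrix of weights, whose eigenvalues have modulus less than
  \<open>1\<close> by the same maximum principle (\<open>summable_cycle_weights\<close>).
\<close>

unbundle no vec_syntax

section \<open>Traces, eigenvalues and the logarithm of a determinant\<close>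

lemma index_mult_mat_sum:
  fixes A B :: "'a :: semiring_0 mat"
  assumes "A \<in> carrier_mat n m" "B \<in> carrier_mat m k" "a < n" "b < k"
  shows "(A * B) $$ (a, b) = (\<Sum>c<m. A $$ (a, c) * B $$ (c, b))"
  using assms by (auto simp: scalar_prod_def atLeast0LessThan intro!: sum.cong)

lemma pow_mat_comm:
  fixes A :: "'a :: semiring_1 mat"
  assumes A: "A \<in> carrier_mat n n"
  shows "A * A ^\<^sub>m k = A ^\<^sub>m k * A"
proof (induction k)
  case (Suc k)
  have Ak: "A ^\<^sub>m k \<in> carrier_mat n n" using A by simp
  have "A * (A ^\<^sub>m k * A) = A * A ^\<^sub>m k * A" using assoc_mult_mat[OF A Ak A] by simp
  then show ?case using Suc by simp
qed (use A in auto)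

definition mat_trace :: "'a :: comm_monoid_add mat \<Rightarrow> 'a" where
  "mat_trace A = (\<Sum>i<dim_row A. A $$ (i, i))"

lemma mat_trace_mult_comm:
  fixes A B :: "'a :: comm_semiring_0 mat"
  assumes A: "A \<in> carrier_mat n m" and B: "B \<in> carrier_mat m n"
  shows "mat_trace (A * B) = mat_trace (B * A)"
proof -
  have "mat_trace (A * B) = (\<Sum>i<n. \<Sum>j<m. A $$ (i, j) * B $$ (j, i))"
    using A B by (auto simp: mat_trace_def scalar_prod_def atLeast0LessThan intro!: sum.cong)
  also have "\<dots> = (\<Sum>j<m. \<Sum>i<n. A $$ (i, j) * B $$ (j, i))"
    by (rule sum.swap)
  also have "\<dots> = mat_trace (B * A)"
    using A B
    by (auto simp: mat_trace_def scalar_prod_def atLeast0LessThan mult.commute intro!: sum.cong)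
  finally show ?thesis .
qed

text \<open>
  The diagonal of a product of upper triangular matrices is the product of the diagonals, since in
  the sum for a diagonal entry every other term has a factor below the diagonal.
\<close>

lemma upper_triangular_pow_mat:
  fixes B :: "'a :: comm_semiring_1 mat"
  assumes B: "B \<in> carrier_mat n n" and ut: "upper_triangular B"
  shows "upper_triangular (B ^\<^sub>m k) \<and> (\<forall>i<n. (B ^\<^sub>m k) $$ (i, i) = (B $$ (i, i)) ^ k)"
proof (induction k)
  case 0
  then show ?case using B by auto
next
  case (Suc k)
  have Bk: "B ^\<^sub>m k \<in> carrier_mat n n" using B by simp
  have entry: "(B ^\<^sub>m Suc k) $$ (i, j) = (\<Sum>l<n. (B ^\<^sub>m k) $$ (i, l) * B $$ (l, j))"
    if "i < n" "j < n" for i j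
    using index_mult_mat_sum[OF Bk B that] by simp
  have Bk0: "(B ^\<^sub>m k) $$ (i, l) = 0" if "l < i" "i < n" for i l
    using Suc Bk that by (auto dest: upper_triangularD)
  have B0: "B $$ (i, l) = 0" if "l < i" "i < n" for i l
    using ut B that by (auto dest: upper_triangularD)
  have low: "(B ^\<^sub>m Suc k) $$ (i, j) = 0" if "j < i" "i < n" for i j
  proof -
    have "(B ^\<^sub>m k) $$ (i, l) * B $$ (l, j) = 0" if "l < n" for l
      using Bk0[of l i] B0[of j l] \<open>j < i\<close> \<open>i < n\<close> that by (cases "l < i") auto
    then show ?thesis using entry[of i j] that by simp
  qed
  have diag: "(B ^\<^sub>m Suc k) $$ (i, i) = (B $$ (i, i)) ^ Suc k" if "i < n" for i
  proof -
    have "(B ^\<^sub>m k) $$ (i, l) * B $$ (l, i) = (if l = i then (B $$ (i, i)) ^ Suc k else 0)"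
      if "l < n" for l
      using Bk0[of l i] B0[of i l] Suc \<open>i < n\<close> that
      by (cases l i rule: linorder_cases) (auto simp: mult.commute)
    then show ?thesis using entry[of i i] that by simp
  qed
  show ?case
    using low diag B Bk by (auto intro!: upper_triangularI simp del: pow_mat.simps)
qed

text \<open>
  Triangularising \<open>A\<close> by a Schur decomposition exhibits \<open>det (1 - A)\<close> and all the power traces as
  functions of one list of eigenvalues.
\<close>

lemma eigenvalue_list:
  fixes A :: "complex mat"
  assumes A: "A \<in> carrier_mat n n"
  obtains es where "length es = n" "\<And>e. e \<in> set es \<Longrightarrow> eigenvalue A e"
    "det (1\<^sub>m n - A) = (\<Prod>i<n. 1 - es ! i)" "\<And>k. mat_trace (A ^\<^sub>m k) = (\<Sum>i<n. (es ! i) ^ k)"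
proof -
  obtain es where cp: "char_poly A = (\<Prod>e\<leftarrow>es. [:- e, 1:])" and len: "length es = n"
    using char_poly_factorized[OF A] by auto
  obtain T P Q where TPQ: "schur_decomposition A es = (T, P, Q)"
    by (metis prod_cases3)
  from schur_decomposition[OF A cp TPQ]
  have wit: "similar_mat_wit A T P Q" and ut: "upper_triangular T" and diag: "diag_mat T = es"
    by auto
  have car: "T \<in> carrier_mat n n" "P \<in> carrier_mat n n" "Q \<in> carrier_mat n n"
    and QP: "Q * P = 1\<^sub>m n"
    using similar_mat_witD2[OF A wit] by auto
  have Tii: "T $$ (i, i) = es ! i" if "i < n" for i
    using diag that car by (auto simp: diag_mat_def)
  show thesis
  proof
    show "length es = n" by fact
    show "eigenvalue A e" if "e \<in> set es" for e
    proof -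
      have "poly (char_poly A) e = 0"
        using that unfolding cp poly_prod_list prod_list_zero_iff by (auto intro!: image_eqI)
      then show ?thesis using eigenvalue_root_char_poly[OF A] by simp
    qed
    \<comment> \<open>The determinant is the characteristic polynomial evaluated at \<open>1\<close>.\<close>
    have "1\<^sub>m n - A = - char_matrix A 1"
      using A by (auto simp: char_matrix_def)
    then have "det (1\<^sub>m n - A) = poly (char_poly A) 1"
      using char_poly_matrix[OF A, of 1] by simp
    also have "\<dots> = (\<Prod>e\<leftarrow>es. 1 - e)"
      unfolding cp poly_prod_list by (simp add: o_def)
    also have "\<dots> = (\<Prod>i<n. 1 - es ! i)"
      by (simp add: prod.list_conv_set_nth len atLeast0LessThan)
    finally show "det (1\<^sub>m n - A) = (\<Prod>i<n. 1 - es ! i)" .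
    show "mat_trace (A ^\<^sub>m k) = (\<Sum>i<n. (es ! i) ^ k)" for k
    proof -
      have Tk: "T ^\<^sub>m k \<in> carrier_mat n n" using car by simp
      have "mat_trace (A ^\<^sub>m k) = mat_trace (P * (T ^\<^sub>m k) * Q)"
        using similar_mat_wit_pow_id[OF wit] by simp
      also have "\<dots> = mat_trace (Q * (P * (T ^\<^sub>m k)))"
        by (rule mat_trace_mult_comm[where n = n and m = n]) (use car Tk in auto)
      also have "Q * (P * (T ^\<^sub>m k)) = Q * P * (T ^\<^sub>m k)"
        using car Tk by (intro assoc_mult_mat[symmetric]) auto
      also have "\<dots> = T ^\<^sub>m k" using QP left_mult_one_mat[OF Tk] by simp
      also have "mat_trace (T ^\<^sub>m k) = (\<Sum>i<n. (es ! i) ^ k)"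
        using upper_triangular_pow_mat[OF car(1) ut, of k] Tk
        by (auto simp: mat_trace_def Tii)
      finally show ?thesis .
    qed
  qed
qed

text \<open>
  The trace is the sum of the eigenvalues. If \<open>A\<close> shrinks some norm by a factor \<open>r\<close>, the
  assumption holds, so the bound does not depend on that norm.
\<close>

lemma norm_mat_trace_le:
  fixes A :: "complex mat"
  assumes A: "A \<in> carrier_mat n n" and ev: "\<And>e. eigenvalue A e \<Longrightarrow> cmod e \<le> r"
  shows "cmod (mat_trace A) \<le> real n * r"
proof -
  obtain es where es: "length es = n" "\<And>e. e \<in> set es \<Longrightarrow> eigenvalue A e"
    "\<And>k. mat_trace (A ^\<^sub>m k) = (\<Sum>i<n. (es ! i) ^ k)"
    using eigenvalue_list[OF A] by metis
  have "mat_trace A = (\<Sum>i<n. es ! i)"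
    using es(3)[of 1] A by simp
  also have "cmod \<dots> \<le> (\<Sum>i<n. r)"
    by (intro sum_norm_le ev es(2)) (simp add: es(1))
  finally show ?thesis by simp
qed

lemma has_sum_sum:
  fixes f :: "'i \<Rightarrow> 'k \<Rightarrow> 'a :: topological_comm_monoid_add"
  assumes "finite I" and "\<And>i. i \<in> I \<Longrightarrow> (f i has_sum s i) A"
  shows "((\<lambda>k. \<Sum>i\<in>I. f i k) has_sum (\<Sum>i\<in>I. s i)) A"
  using assms by (induction I rule: finite_induct) (auto intro!: has_sum_add)

lemma has_sum_log:
  fixes e :: complex
  assumes "cmod e < 1"
  shows "((\<lambda>k. e ^ Suc k / of_nat (Suc k)) has_sum (- ln (1 - e))) UNIV"
proof (rule norm_summable_imp_has_sum)
  have "(\<lambda>k. - (e ^ k / of_nat k)) sums ln (1 - e)"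
    using Ln_series'[of "- e"] assms by simp
  then have "(\<lambda>k. e ^ k / of_nat k) sums (- ln (1 - e))"
    using sums_minus by fastforce
  then show "(\<lambda>k. e ^ Suc k / of_nat (Suc k)) sums (- ln (1 - e))"
    by (subst sums_Suc_iff) simp
  have "summable (\<lambda>k. cmod e ^ Suc k)"
    using assms by (subst summable_Suc_iff) (simp add: summable_geometric)
  then show "summable (\<lambda>k. cmod (e ^ Suc k / of_nat (Suc k)))"
  proof (rule summable_comparison_test')
    fix k :: nat
    have "cmod e ^ Suc k / real (Suc k) \<le> cmod e ^ Suc k / 1"
      by (intro divide_left_mono) auto
    then show "norm (cmod (e ^ Suc k / of_nat (Suc k))) \<le> cmod e ^ Suc k"
      by (simp add: norm_divide norm_power norm_mult del: power_Suc of_nat_Suc)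
  qed
qed

text \<open>
  In terms of the eigenvalues this is the Taylor series of \<open>ln (1 - e)\<close>, summed over the
  eigenvalues \<open>e\<close>.
\<close>

lemma det_one_minus_eq_exp_traces:
  fixes A :: "complex mat"
  assumes A: "A \<in> carrier_mat n n" and ev: "\<And>e. eigenvalue A e \<Longrightarrow> cmod e < 1"
  shows "det (1\<^sub>m n - A) = exp (- (\<Sum>\<^sub>\<infinity>k. mat_trace (A ^\<^sub>m Suc k) / of_nat (Suc k)))"
proof -
  obtain es where es: "length es = n" "\<And>e. e \<in> set es \<Longrightarrow> eigenvalue A e"
    "det (1\<^sub>m n - A) = (\<Prod>i<n. 1 - es ! i)"
    "\<And>k. mat_trace (A ^\<^sub>m k) = (\<Sum>i<n. (es ! i) ^ k)"
    using eigenvalue_list[OF A] by metis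
  have lt: "cmod (es ! i) < 1" if "i < n" for i
    using that es(1,2) ev by auto
  have "((\<lambda>k. \<Sum>i<n. (es ! i) ^ Suc k / of_nat (Suc k)) has_sum (\<Sum>i<n. - ln (1 - es ! i))) UNIV"
    by (intro has_sum_sum has_sum_log lt) simp_all
  also have "(\<lambda>k. \<Sum>i<n. (es ! i) ^ Suc k / of_nat (Suc k)) =
      (\<lambda>k. mat_trace (A ^\<^sub>m Suc k) / of_nat (Suc k))"
    by (simp only: es(4) sum_divide_distrib)
  finally have "(\<Sum>\<^sub>\<infinity>k. mat_trace (A ^\<^sub>m Suc k) / of_nat (Suc k)) = (\<Sum>i<n. - ln (1 - es ! i))"
    by (rule infsumI)
  then have "exp (- (\<Sum>\<^sub>\<infinity>k. mat_trace (A ^\<^sub>m Suc k) / of_nat (Suc k))) = (\<Prod>i<n. exp (ln (1 - es ! i)))"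
    by (simp add: sum_negf exp_sum)
  also have "\<dots> = (\<Prod>i<n. 1 - es ! i)"
    using lt by (intro prod.cong refl exp_Ln) fastforce
  finally show ?thesis using es(3) by simp
qed

lemma summable_mat_trace_pow:
  fixes A :: "complex mat"
  assumes A: "A \<in> carrier_mat n n" and ev: "\<And>e. eigenvalue A e \<Longrightarrow> cmod e < 1"
  shows "summable (\<lambda>k. cmod (mat_trace (A ^\<^sub>m k)))"
proof -
  obtain es where es: "length es = n" "\<And>e. e \<in> set es \<Longrightarrow> eigenvalue A e"
    "\<And>k. mat_trace (A ^\<^sub>m k) = (\<Sum>i<n. (es ! i) ^ k)"
    using eigenvalue_list[OF A] by metis
  have "summable (\<lambda>k. \<Sum>i<n. cmod (es ! i) ^ k)"
    using es(1,2) ev by (intro summable_sum summable_geometric) auto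
  then show ?thesis
    by (rule summable_comparison_test')
      (auto simp: es(3) norm_power intro!: norm_sum[THEN order_trans])
qed

section \<open>Primitive words and cyclic classes\<close>

lemma length_concat_replicate: "length (concat (replicate k u)) = k * length u"
  by (induction k) auto

lemma nth_concat_replicate:
  "i < k * length u \<Longrightarrow> concat (replicate k u) ! i = u ! (i mod length u)"
proof (induction k arbitrary: i)
  case (Suc k)
  show ?case
  proof (cases "i < length u")
    case False
    then show ?thesis using Suc by (simp add: nth_append le_mod_geq)
  qed (simp add: nth_append)
qed simp

lemma rotate_concat_replicate:
  "rotate m (concat (replicate k u)) = concat (replicate k (rotate m u))"
proof (rule nth_equalityI)
  fix i assume "i < length (rotate m (concat (replicate k u)))"
  then have i: "i < k * length u" by (simp add: length_concat_replicate)
  then have u: "0 < length u" by (cases u) auto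
  have "rotate m (concat (replicate k u)) ! i
      = concat (replicate k u) ! ((m + i) mod (k * length u))"
    using i by (simp add: nth_rotate length_concat_replicate)
  also have "\<dots> = u ! ((m + i) mod (k * length u) mod length u)"
    using i u by (intro nth_concat_replicate mod_less_divisor) (cases k, auto)
  also have "(m + i) mod (k * length u) mod length u = (m + i mod length u) mod length u"
    by (simp add: mod_mod_cancel mod_simps)
  also have "u ! \<dots> = concat (replicate k (rotate m u)) ! i"
    using i u by (simp add: nth_rotate nth_concat_replicate)
  finally show "rotate m (concat (replicate k u)) ! i = concat (replicate k (rotate m u)) ! i" .
qed (simp add: length_concat_replicate)

lemma concat_replicate_Suc_inject:
  assumes "concat (replicate (Suc k) u) = concat (replicate (Suc l) v)" "length u = length v"
  shows "u = v"
  using assms by simp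

text \<open>
  Since periods that fix a word reduce modulo its length, it suffices to test the rotations by less
  than the length; this is the condition that the stabiliser of the word is trivial.
\<close>

definition primitive :: "'a list \<Rightarrow> bool" where
  "primitive u \<longleftrightarrow> u \<noteq> [] \<and> (\<forall>m<length u. rotate m u = u \<longrightarrow> m = 0)"

lemma rotate_mult_fixed: "rotate m w = w \<Longrightarrow> rotate (m * q) w = w"
proof (induction q)
  case (Suc q)
  have "rotate (m * Suc q) w = rotate m (rotate (m * q) w)"
    by (simp only: rotate_rotate mult_Suc_right)
  also have "\<dots> = w" by (simp only: Suc)
  finally show ?case .
qed simp

lemma rotate_mod_fixed:
  assumes "rotate a w = w" "rotate b w = w"
  shows "rotate (a mod b) w = w"
proof -
  have "w = rotate (a mod b + b * (a div b)) w" using assms(1) by simp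
  also have "\<dots> = rotate (a mod b) w"
    using rotate_mult_fixed[OF assms(2)] by (simp only: rotate_rotate[symmetric])
  finally show ?thesis by simp
qed

lemma primitive_dvd:
  assumes "primitive u" "rotate m u = u"
  shows "length u dvd m"
proof -
  have "rotate (m mod length u) u = u" using assms(2) rotate_conv_mod[of m u] by simp
  then have "m mod length u = 0" using assms(1) by (auto simp: primitive_def)
  then show ?thesis by (rule mod_0_imp_dvd)
qed

text \<open>
  Rotation by \<open>m\<close> is undone by rotating further to the next multiple of the length.
\<close>

lemma rotate_cancel:
  assumes "rotate m u = rotate m v" "length u = length v"
  shows "u = v"
proof -
  have "rotate (length w * m) w = w" for w :: "'a list"
    using rotate_mult_fixed[of "length w" w m] by simp
  then have eq: "rotate (length w * m - m) (rotate m w) = w" if "w \<noteq> []" for w :: "'a list"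
    using that by (simp add: rotate_rotate Suc_le_eq)
  show ?thesis
    using eq[of u] eq[of v] assms by (cases "u = []") auto
qed

lemma primitive_rotate: "primitive u \<Longrightarrow> primitive (rotate m u)"
  unfolding primitive_def
proof (elim conjE, intro conjI allI impI)
  fix j
  assume min: "\<forall>m<length u. rotate m u = u \<longrightarrow> m = 0"
    and j: "j < length (rotate m u)" "rotate j (rotate m u) = rotate m u"
  have "rotate m (rotate j u) = rotate m u"
    using j(2) by (simp only: rotate_rotate add.commute)
  then have "rotate j u = u" by (rule rotate_cancel) simp
  then show "j = 0" using min j(1) by simp
qed simp

text \<open>The shortest period of a nonempty word divides its length and cuts out its primitive root.\<close>

lemma primitive_root_exists:
  assumes "w \<noteq> []"
  obtains u k where "primitive u" "w = concat (replicate (Suc k) u)"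
proof -
  define d where "d = (LEAST d. 0 < d \<and> rotate d w = w)"
  have ex: "0 < length w \<and> rotate (length w) w = w" using assms by simp
  have d: "0 < d" "rotate d w = w" and least: "\<And>m. 0 < m \<Longrightarrow> rotate m w = w \<Longrightarrow> d \<le> m"
    using LeastI[where P = "\<lambda>d. 0 < d \<and> rotate d w = w", OF ex]
    unfolding d_def by (auto intro: Least_le)
  have dle: "d \<le> length w" using least[of "length w"] ex by simp
  have "rotate (length w mod d) w = w" by (rule rotate_mod_fixed) (use d in auto)
  with least[of "length w mod d"] d have "length w mod d = 0"
    by (meson mod_less_divisor not_gr_zero not_le)
  then obtain q where q: "length w = q * d" by (metis mod_0_imp_dvd dvd_def mult.commute)
  define u where "u = take d w"
  have lu: "length u = d" using dle by (simp add: u_def)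
  have w: "w = concat (replicate q u)"
  proof (rule nth_equalityI)
    show "length w = length (concat (replicate q u))" by (simp add: length_concat_replicate q lu)
    fix i assume i: "i < length w"
    have im: "i mod d < d" using d by simp
    have "w ! (i mod d) = rotate (d * (i div d)) w ! (i mod d)"
      using rotate_mult_fixed[OF d(2)] by simp
    also have "\<dots> = w ! i"
      using i im dle by (subst nth_rotate) auto
    finally show "w ! i = concat (replicate q u) ! i"
      using i im q lu by (simp add: nth_concat_replicate u_def)
  qed
  have "q \<noteq> 0" using q ex by auto
  then obtain k where k: "q = Suc k" by (cases q) auto
  have "primitive u"
    unfolding primitive_def
  proof (intro conjI allI impI)
    show "u \<noteq> []" using lu d by auto
    fix m assume m: "m < length u" "rotate m u = u"
    then have "rotate m w = w" by (simp only: w rotate_concat_replicate)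
    then show "m = 0" using least[of m] m lu by (cases "m = 0") auto
  qed
  with w k show thesis using that by blast
qed

text \<open>
  Equal powers of \<open>u\<close> and \<open>v\<close> are fixed by the rotations by \<open>length u\<close> and by \<open>length v\<close>. A rotation
  that fixes a power fixes its base, so each of the two lengths divides the other.
\<close>

lemma primitive_root_unique:
  assumes u: "primitive u" and v: "primitive v"
    and eq: "concat (replicate (Suc k) u) = concat (replicate (Suc l) v)"
  shows "u = v \<and> k = l"
proof -
  have dvd: "length v dvd length u"
    if "primitive v" "concat (replicate (Suc k) u) = concat (replicate (Suc l) v)"
    for u v :: "'a list" and k l
  proof -
    have "concat (replicate (Suc l) (rotate (length u) v)) = concat (replicate (Suc l) v)"
      using rotate_concat_replicate[of "length u" "Suc l" v]
        rotate_concat_replicate[of "length u" "Suc k" u] that(2) by simp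
    then have "rotate (length u) v = v"
      by (rule concat_replicate_Suc_inject) simp
    with that(1) show ?thesis by (rule primitive_dvd)
  qed
  have len: "length u = length v"
    using dvd[OF v eq] dvd[OF u eq[symmetric]] by (rule dvd_antisym[rotated])
  have "u = v" using eq len by (rule concat_replicate_Suc_inject)
  moreover have "Suc k * length u = Suc l * length v"
    using arg_cong[OF eq, of length] by (simp only: length_concat_replicate)
  ultimately show ?thesis using u by (auto simp: primitive_def)
qed

lemma range_rotate_rotate: "range (\<lambda>m. rotate m (rotate j w)) = range (\<lambda>m. rotate m w)"
proof -
  have "\<exists>k. rotate m w = rotate k (rotate j w)" for m
  proof (cases "w = []")
    case False
    have "rotate (m + length w * j) w = rotate m (rotate (length w * j) w)"
      by (simp only: rotate_rotate)
    also have "rotate (length w * j) w = w" by (rule rotate_mult_fixed) simp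
    finally have "rotate m w = rotate (m + length w * j) w" ..
    also have "m + length w * j = (m + length w * j - j) + j"
      using False by (simp add: Suc_le_eq trans_le_add2)
    finally have "rotate m w = rotate (m + length w * j - j) (rotate j w)"
      by (simp only: rotate_rotate)
    then show ?thesis by blast
  qed simp
  then show ?thesis by (auto simp: rotate_rotate)
qed

lemma cyclic_class:
  assumes "c \<in> W // cyclic_perm" and rot: "\<And>w m. w \<in> W \<Longrightarrow> rotate m w \<in> W"
  shows "cycle_rep c \<in> c" and "c \<subseteq> W" and "\<And>w. w \<in> c \<Longrightarrow> c = range (\<lambda>m. rotate m w)"
proof -
  obtain w where w: "w \<in> W" and c: "c = range (\<lambda>m. rotate m w)"
    using assms(1) by (auto simp: quotient_def cyclic_perm_def)
  show "cycle_rep c \<in> c"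
    unfolding cycle_rep_def by (rule someI_ex) (auto simp: c)
  show "c \<subseteq> W" using rot w by (auto simp: c)
  show "c = range (\<lambda>m. rotate m w')" if "w' \<in> c" for w'
    using that range_rotate_rotate[of _ w] unfolding c by blast
qed

lemma valuation_eq_1_iff:
  assumes "cycle_rep c \<noteq> []"
  shows "valuation c = 1 \<longleftrightarrow> primitive (cycle_rep c)"
proof -
  let ?S = "{m \<in> {..<length (cycle_rep c)}. rotate m (cycle_rep c) = cycle_rep c}"
  have singleton: "card S = 1 \<longleftrightarrow> (\<forall>m\<in>S. m = 0)" if "0 \<in> S" for S :: "nat set"
    using that by (auto simp: card_1_singleton_iff)
  have "card ?S = 1 \<longleftrightarrow> (\<forall>m\<in>?S. m = 0)" by (rule singleton) (use assms in simp)
  also have "\<dots> \<longleftrightarrow> primitive (cycle_rep c)"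
    unfolding primitive_def Ball_def mem_Collect_eq lessThan_iff imp_conjL using assms
    by (simp only: simp_thms)
  finally show ?thesis unfolding valuation_def .
qed

lemma abs_summable_on_divide_length:
  fixes F :: "'a list \<Rightarrow> complex"
  assumes "F abs_summable_on W"
  shows "(\<lambda>w. F w / of_nat (length w)) abs_summable_on W"
proof (rule abs_summable_on_comparison_test[OF assms])
  fix w :: "'a list"
  show "cmod (F w / of_nat (length w)) \<le> cmod (F w)"
  proof (cases "w = []")
    case False
    then have "1 \<le> real (length w)" by (simp add: Suc_le_eq)
    then have "cmod (F w) / real (length w) \<le> cmod (F w) / 1" by (intro divide_left_mono) auto
    then show ?thesis by (simp add: norm_divide)
  qed simp
qed

text \<open>
  The words in \<open>W\<close> are parametrised bijectively by triples \<open>(c, m, k)\<close>: the class \<open>c\<close> of the primitive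
  root, the rotation \<open>m\<close> less than the length \<open>L c\<close> of the representative that turns it into the root,
  and the exponent \<open>Suc k\<close>. The summand is independent of \<open>m\<close>, so summing over \<open>m\<close> cancels the factor \<open>L c\<close>
  of the length \<open>Suc k * L c\<close>.
\<close>

lemma sum_over_words_eq_sum_over_primitive_classes:
  fixes F :: "'a list \<Rightarrow> complex" and W :: "'a list set"
  defines "C \<equiv> {c \<in> W // cyclic_perm. valuation c = 1}"
  assumes ne: "[] \<notin> W" and rot: "\<And>w m. w \<in> W \<Longrightarrow> rotate m w \<in> W"
    and root: "\<And>u k. concat (replicate (Suc k) u) \<in> W \<longleftrightarrow> u \<in> W"
    and Frot: "\<And>w m. w \<in> W \<Longrightarrow> F (rotate m w) = F w"
    and summ: "F abs_summable_on W"
  shows "(\<lambda>c. \<Sum>\<^sub>\<infinity>k. F (concat (replicate (Suc k) (cycle_rep c))) / of_nat (Suc k)) abs_summable_on C"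
    and "(\<Sum>\<^sub>\<infinity>c\<in>C. \<Sum>\<^sub>\<infinity>k. F (concat (replicate (Suc k) (cycle_rep c))) / of_nat (Suc k))
      = (\<Sum>\<^sub>\<infinity>w\<in>W. F w / of_nat (length w))"
proof -
  define q where "q c k = F (concat (replicate (Suc k) (cycle_rep c))) / of_nat (Suc k)" for c k
  define L where "L c = length (cycle_rep c)" for c :: "'a list set"
  define G where "G w = F w / of_nat (length w)" for w
  define T where "T = (SIGMA c:C. {..<L c} \<times> (UNIV :: nat set))"
  define h :: "'a list set \<times> nat \<times> nat \<Rightarrow> 'a list"
    where "h = (\<lambda>(c, m, k). concat (replicate (Suc k) (rotate m (cycle_rep c))))"
  have rep: "cycle_rep c \<in> W" "primitive (cycle_rep c)" "cycle_rep c \<in> c" "0 < L c"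
    if "c \<in> C" for c
  proof -
    have c: "c \<in> W // cyclic_perm" "valuation c = 1" using that by (auto simp: C_def)
    show "cycle_rep c \<in> c" "cycle_rep c \<in> W" using cyclic_class(1,2)[of c W, OF _ rot] c by auto
    then have "cycle_rep c \<noteq> []" using ne by auto
    then show "primitive (cycle_rep c)" "0 < L c" using valuation_eq_1_iff c by (auto simp: L_def)
  qed
  have class_eq: "c = range (\<lambda>m. rotate m w)" if "c \<in> C" "w \<in> c" for c w
    using that cyclic_class(3)[OF _ rot] by (auto simp: C_def)
  have bij: "bij_betw h T W"
  proof (rule bij_betw_imageI)
    show "inj_on h T"
    proof (rule inj_onI, clarsimp simp: T_def h_def simp del: replicate_Suc)
      fix c m k c' m' k'
      assume c: "c \<in> C" "c' \<in> C" "m < L c" "m' < L c'"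
        and words: "concat (replicate (Suc k) (rotate m (cycle_rep c)))
            = concat (replicate (Suc k') (rotate m' (cycle_rep c')))"
      have eq: "rotate m (cycle_rep c) = rotate m' (cycle_rep c')" and "k = k'"
        using primitive_root_unique[OF _ _ words] primitive_rotate[OF rep(2)] c by auto
      have "rotate m (cycle_rep c) \<in> c" "rotate m' (cycle_rep c') \<in> c'"
        using class_eq[OF c(1) rep(3)] class_eq[OF c(2) rep(3)] c by blast+
      then have cc': "c = c'"
        using class_eq[OF c(1)] class_eq[OF c(2)] eq by metis
      have le: "i = j"
        if "rotate i (cycle_rep c) = rotate j (cycle_rep c)" "i \<le> j" "j < L c" for i j
      proof -
        have "rotate i (rotate (j - i) (cycle_rep c)) = rotate i (cycle_rep c)"
          using that by (simp add: rotate_rotate)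
        then have "rotate (j - i) (cycle_rep c) = cycle_rep c" by (rule rotate_cancel) simp
        then have "L c dvd j - i" unfolding L_def by (rule primitive_dvd[OF rep(2)[OF c(1)]])
        then show "i = j" using that by (auto dest: dvd_imp_le)
      qed
      have "m = m'"
        using le[of m m'] le[of m' m] eq c cc' by (cases "m \<le> m'") auto
      then show "c = c' \<and> m = m' \<and> k = k'" using cc' \<open>k = k'\<close> by simp
    qed
    show "h ` T = W"
    proof (intro equalityI subsetI)
      fix w assume "w \<in> h ` T"
      then show "w \<in> W"
        using rep(1) rot root by (auto simp: T_def h_def simp del: replicate_Suc)
    next
      fix w assume w: "w \<in> W"
      then obtain u k where u: "primitive u" "w = concat (replicate (Suc k) u)"
        using ne primitive_root_exists by metis
      then have uW: "u \<in> W" using w root by blast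
      define c where "c = range (\<lambda>m. rotate m u)"
      have "c = cyclic_perm `` {u}" by (auto simp: c_def cyclic_perm_def)
      then have cq: "c \<in> W // cyclic_perm" using uW by (auto intro: quotientI)
      have "primitive v" if "v \<in> c" for v
        using that u(1) by (auto simp: c_def intro: primitive_rotate)
      then have "primitive (cycle_rep c)" using cyclic_class(1)[OF cq rot] by blast
      then have "valuation c = 1"
        using valuation_eq_1_iff[of c] primitive_def by blast
      with cq have cC: "c \<in> C" unfolding C_def by blast
      have "u \<in> c" unfolding c_def by (rule range_eqI[of _ _ 0]) simp
      then obtain m where "u = rotate m (cycle_rep c)"
        using class_eq[OF cC rep(3)[OF cC]] by blast
      then have "u = rotate (m mod L c) (cycle_rep c)"
        using rotate_conv_mod[of m "cycle_rep c"] by (simp add: L_def)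
      then have "w = h (c, m mod L c, k)" by (simp add: h_def u(2) del: replicate_Suc)
      moreover have "(c, m mod L c, k) \<in> T" using cC rep(4) by (simp add: T_def)
      ultimately show "w \<in> h ` T" by blast
    qed
  qed
  have Gh: "G (h (c, m, k)) = q c k / of_nat (L c)" if "c \<in> C" for c m k
  proof -
    have "concat (replicate (Suc k) (cycle_rep c)) \<in> W" using rep(1)[OF that] root by blast
    then have "F (h (c, m, k)) = F (concat (replicate (Suc k) (cycle_rep c)))"
      by (simp only: h_def prod.case rotate_concat_replicate[symmetric] Frot)
    then show ?thesis
      by (simp add: G_def q_def L_def h_def length_concat_replicate del: replicate_Suc of_nat_Suc mult_Suc)
  qed
  have "G abs_summable_on W"
    unfolding G_def by (rule abs_summable_on_divide_length[OF summ])
  then have absT: "(\<lambda>t. G (h t)) abs_summable_on T"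
    using summable_on_reindex_bij_betw[OF bij, of "\<lambda>w. norm (G w)"] by simp
  have abs_inner: "(\<lambda>y. G (h (c, y))) abs_summable_on {..<L c} \<times> UNIV" if "c \<in> C" for c
    using iffD1[OF abs_summable_on_Sigma_iff absT[unfolded T_def]] that by blast
  have abs_outer: "(\<lambda>c. \<Sum>\<^sub>\<infinity>y\<in>{..<L c} \<times> UNIV. norm (G (h (c, y)))) abs_summable_on C"
    using iffD1[OF abs_summable_on_Sigma_iff absT[unfolded T_def]] by blast
  have inner: "(\<Sum>\<^sub>\<infinity>y\<in>{..<L c} \<times> UNIV. G (h (c, y))) = (\<Sum>\<^sub>\<infinity>k. q c k)" if c: "c \<in> C" for c
  proof -
    have "(\<Sum>\<^sub>\<infinity>y\<in>{..<L c} \<times> UNIV. G (h (c, y))) = (\<Sum>\<^sub>\<infinity>m\<in>{..<L c}. \<Sum>\<^sub>\<infinity>k. G (h (c, m, k)))"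
      by (rule infsum_Sigma_banach[OF abs_summable_summable[OF abs_inner[OF c]], symmetric])
    also have "\<dots> = (\<Sum>m<L c. \<Sum>\<^sub>\<infinity>k. q c k / of_nat (L c))"
      using Gh[OF c] by simp
    also have "\<dots> = (\<Sum>\<^sub>\<infinity>k. q c k)"
      using rep(4)[OF c] by (simp add: divide_inverse infsum_cmult_left')
    finally show ?thesis .
  qed
  show "(\<lambda>c. \<Sum>\<^sub>\<infinity>k. F (concat (replicate (Suc k) (cycle_rep c))) / of_nat (Suc k)) abs_summable_on C"
    unfolding q_def[symmetric]
  proof (rule abs_summable_on_comparison_test)
    show "(\<lambda>c. \<Sum>\<^sub>\<infinity>y\<in>{..<L c} \<times> UNIV. norm (G (h (c, y)))) abs_summable_on C"
      by (fact abs_outer)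
    fix c assume c: "c \<in> C"
    have "norm (\<Sum>\<^sub>\<infinity>y\<in>{..<L c} \<times> UNIV. G (h (c, y))) \<le> (\<Sum>\<^sub>\<infinity>y\<in>{..<L c} \<times> UNIV. norm (G (h (c, y))))"
      by (rule norm_infsum_bound[OF abs_inner[OF c]])
    then show "norm (\<Sum>\<^sub>\<infinity>k. q c k) \<le> norm (\<Sum>\<^sub>\<infinity>y\<in>{..<L c} \<times> UNIV. norm (G (h (c, y))))"
      using inner[OF c] by simp
  qed
  have "(\<Sum>\<^sub>\<infinity>w\<in>W. G w) = (\<Sum>\<^sub>\<infinity>t\<in>T. G (h t))"
    using infsum_reindex_bij_betw[OF bij, of G] by simp
  also have "\<dots> = (\<Sum>\<^sub>\<infinity>c\<in>C. \<Sum>\<^sub>\<infinity>y\<in>{..<L c} \<times> UNIV. G (h (c, y)))"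
    unfolding T_def
    by (rule infsum_Sigma_banach[OF abs_summable_summable[OF absT[unfolded T_def]], symmetric])
  also have "\<dots> = (\<Sum>\<^sub>\<infinity>c\<in>C. \<Sum>\<^sub>\<infinity>k. q c k)"
    by (rule infsum_cong[OF inner])
  finally show "(\<Sum>\<^sub>\<infinity>c\<in>C. \<Sum>\<^sub>\<infinity>k. F (concat (replicate (Suc k) (cycle_rep c))) / of_nat (Suc k))
      = (\<Sum>\<^sub>\<infinity>w\<in>W. F w / of_nat (length w))"
    by (simp add: G_def q_def)
qed

section \<open>Infinite products of exponentials\<close>

text \<open>
  The finite partial products are exponentials of the finite partial sums, and
  \<open>\<bar>exp z - 1\<bar> \<le> exp \<bar>z\<bar> \<cdot> \<bar>z\<bar>\<close> reduces absolute convergence of the product to that of the sum.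
\<close>

lemma infprod_exp:
  fixes S :: "'i \<Rightarrow> complex"
  assumes S: "S abs_summable_on C" and f: "\<And>c. c \<in> C \<Longrightarrow> f c = exp (S c)"
  shows "abs_convergent_prod_on f C" and "infprod f C = exp (\<Sum>\<^sub>\<infinity>c\<in>C. S c)"
proof -
  define M where "M = (\<Sum>\<^sub>\<infinity>c\<in>C. norm (S c))"
  have le_M: "norm (S c) \<le> M" if "c \<in> C" for c
    using finite_sum_le_infsum[OF S, of "{c}"] that by (simp add: M_def)
  show "abs_convergent_prod_on f C"
    unfolding abs_convergent_prod_on_def
  proof (rule abs_summable_on_comparison_test')
    show "(\<lambda>c. exp M * norm (S c)) summable_on C"
      by (intro summable_on_cmult_right S)
    fix c assume c: "c \<in> C"
    have "norm (exp (S c) - 1) \<le> exp (norm (S c)) * norm (S c)"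
      using Taylor_exp_field[of "S c" 0] by simp
    also have "\<dots> \<le> exp M * norm (S c)"
      using le_M[OF c] by (intro mult_right_mono) auto
    finally show "norm (f c - 1) \<le> exp M * norm (S c)" by (simp add: f[OF c])
  qed
  have "(S has_sum (\<Sum>\<^sub>\<infinity>c\<in>C. S c)) C"
    using abs_summable_summable[OF S] by simp
  then have "((\<lambda>F. exp (\<Sum>c\<in>F. S c)) \<longlongrightarrow> exp (\<Sum>\<^sub>\<infinity>c\<in>C. S c)) (finite_subsets_at_top C)"
    unfolding has_sum_def by (rule tendsto_exp)
  moreover have "exp (\<Sum>c\<in>F. S c) = (\<Prod>c\<in>F. f c)" if "finite F" "F \<subseteq> C" for F
    using that by (subst exp_sum) (auto intro!: prod.cong simp: f)
  ultimately have "((\<lambda>F. \<Prod>c\<in>F. f c) \<longlongrightarrow> exp (\<Sum>\<^sub>\<infinity>c\<in>C. S c)) (finite_subsets_at_top C)"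
    by (auto elim!: Lim_transform_eventually intro!: eventually_finite_subsets_at_top_weakI)
  then show "infprod f C = exp (\<Sum>\<^sub>\<infinity>c\<in>C. S c)"
    unfolding infprod_def by (intro tendsto_Lim) simp_all
qed

section \<open>Block matrices indexed by the vertices\<close>

text \<open>
  The components over the vertices \<open>1, \<dots>, p\<close> are concatenated, so coordinate \<open>i\<close> of the component over
  \<open>v\<close> has position \<open>block_offset n v + i\<close>.
\<close>

definition block_offset :: "(nat \<Rightarrow> nat) \<Rightarrow> nat \<Rightarrow> nat" where
  "block_offset n v = (\<Sum>u\<in>{1..<v}. n u)"

lemma block_offset_Suc: "1 \<le> v \<Longrightarrow> block_offset n (Suc v) = block_offset n v + n v"
  by (simp add: block_offset_def)

lemma block_offset_mono: "v \<le> w \<Longrightarrow> block_offset n v \<le> block_offset n w"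
  unfolding block_offset_def by (rule sum_mono2) auto

lemma block_index_less:
  assumes "1 \<le> v" "v < w" "i < n v"
  shows "block_offset n v + i < block_offset n w"
  using block_offset_mono[of "Suc v" w n] block_offset_Suc[of v n] assms by simp

lemma block_index_inject:
  assumes "1 \<le> v" "1 \<le> w" "i < n v" "j < n w"
  shows "block_offset n v + i = block_offset n w + j \<longleftrightarrow> v = w \<and> i = j"
  using block_index_less[of v w i n] block_index_less[of w v j n] assms
  by (cases v w rule: linorder_cases) auto

lemma block_index_exists:
  assumes "a < block_offset n (Suc p)"
  obtains v i where "v \<in> {1..p}" "i < n v" "a = block_offset n v + i"
proof -
  have "\<exists>v\<in>{1..p}. \<exists>i<n v. a = block_offset n v + i"
    using assms
  proof (induction p)
    case (Suc p)
    show ?case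
    proof (cases "a < block_offset n (Suc p)")
      case True
      then show ?thesis using Suc.IH by fastforce
    next
      case False
      then obtain i where "a = block_offset n (Suc p) + i" by (metis le_Suc_ex not_less)
      moreover from this have "i < n (Suc p)" using Suc.prems block_offset_Suc[of "Suc p" n] by simp
      ultimately show ?thesis by auto
    qed
  qed (simp add: block_offset_def)
  then show thesis using that by blast
qed

text \<open>
  The weights \<open>q\<close> are arbitrary here; the transition probabilities are substituted only at the end.
\<close>

locale quiver_matrices = fin_digraph G
  for G :: "(nat, 'e) pre_digraph" +
  fixes p :: nat and n :: "nat \<Rightarrow> nat" and q :: "'e \<Rightarrow> real" and U :: "'e \<Rightarrow> complex mat"
  assumes verts_eq: "verts G = {1..p}"
    and U_carrier: "e \<in> arcs G \<Longrightarrow> U e \<in> carrier_mat (n (tail G e)) (n (head G e))"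
begin

definition N :: nat where "N = block_offset n (Suc p)"

definition block_proj :: "nat \<Rightarrow> complex mat" where
  "block_proj v = mat (n v) N (\<lambda>(i, a). if a = block_offset n v + i then 1 else 0)"

definition block_incl :: "nat \<Rightarrow> complex mat" where
  "block_incl v = mat N (n v) (\<lambda>(a, i). if a = block_offset n v + i then 1 else 0)"

lemma block_proj_carrier [simp]: "block_proj v \<in> carrier_mat (n v) N"
  and block_incl_carrier [simp]: "block_incl v \<in> carrier_mat N (n v)"
  by (simp_all add: block_proj_def block_incl_def)

lemma block_index_less_N: "v \<in> verts G \<Longrightarrow> i < n v \<Longrightarrow> block_offset n v + i < N"
  unfolding N_def verts_eq by (rule block_index_less) auto

lemma block_index_cases:
  assumes "a < N"
  obtains v i where "v \<in> verts G" "i < n v" "a = block_offset n v + i"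
  using assms block_index_exists unfolding N_def verts_eq by blast

lemma block_index_eq_iff:
  assumes "v \<in> verts G" "w \<in> verts G" "i < n v" "j < n w"
  shows "block_offset n v + i = block_offset n w + j \<longleftrightarrow> v = w \<and> i = j"
  using assms block_index_inject[of v w i n j] unfolding verts_eq by auto

lemma block_proj_mult_vec:
  assumes "v \<in> verts G" "i < n v" "y \<in> carrier_vec N"
  shows "(block_proj v *\<^sub>v y) $ i = y $ (block_offset n v + i)"
proof -
  have "(block_proj v *\<^sub>v y) $ i = (\<Sum>a<N. (if a = block_offset n v + i then 1 else 0) * y $ a)"
    using assms by (auto simp: block_proj_def scalar_prod_def atLeast0LessThan intro!: sum.cong)
  also have "\<dots> = (\<Sum>a<N. if a = block_offset n v + i then y $ a else 0)"
    by (rule sum.cong) auto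
  also have "\<dots> = y $ (block_offset n v + i)"
    using block_index_less_N[OF assms(1,2)] by simp
  finally show ?thesis .
qed

lemma block_proj_mult_incl:
  assumes "v \<in> verts G" "w \<in> verts G"
  shows "block_proj v * block_incl w = (if v = w then 1\<^sub>m (n v) else 0\<^sub>m (n v) (n w))"
proof (rule eq_matI)
  fix i j
  assume "i < dim_row (if v = w then 1\<^sub>m (n v) else 0\<^sub>m (n v) (n w))"
    and "j < dim_col (if v = w then 1\<^sub>m (n v) else 0\<^sub>m (n v) (n w))"
  then have ij: "i < n v" "j < n w" by (auto split: if_splits)
  have "(block_proj v * block_incl w) $$ (i, j)
      = (\<Sum>a<N. block_proj v $$ (i, a) * block_incl w $$ (a, j))"
    using ij by (auto simp: block_proj_def block_incl_def scalar_prod_def atLeast0LessThan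
        intro!: sum.cong)
  also have "\<dots> = (\<Sum>a<N. if a = block_offset n v + i then block_incl w $$ (a, j) else 0)"
    using ij by (intro sum.cong) (auto simp: block_proj_def)
  also have "\<dots> = block_incl w $$ (block_offset n v + i, j)"
    using block_index_less_N[OF assms(1) ij(1)] by simp
  also have "\<dots> = (if v = w \<and> i = j then 1 else 0)"
    using ij block_index_less_N[OF assms(1) ij(1)] block_index_eq_iff[OF assms ij]
    by (simp add: block_incl_def)
  also have "\<dots> = (if v = w then 1\<^sub>m (n v) else 0\<^sub>m (n v) (n w)) $$ (i, j)"
    using ij by auto
  finally show "(block_proj v * block_incl w) $$ (i, j)
      = (if v = w then 1\<^sub>m (n v) else 0\<^sub>m (n v) (n w)) $$ (i, j)" .
qed (auto simp: block_proj_def block_incl_def)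

text \<open>
  Extending \<open>q e \<cdot> U e\<close> by zero to the whole direct sum turns products along arbitrary words of arcs
  into products of square matrices of one size; words that are not walks then contribute zero
  (\<open>word_mat_eq\<close>), so that powers of the sum expand over all words.
\<close>

definition arc_mat :: "'e \<Rightarrow> complex mat" where
  "arc_mat e = block_incl (tail G e) * (of_real (q e) \<cdot>\<^sub>m U e) * block_proj (head G e)"

definition transfer_mat :: "complex mat" where
  "transfer_mat = mat N N (\<lambda>(a, b). \<Sum>e\<in>arcs G. arc_mat e $$ (a, b))"

definition word_mat :: "'e list \<Rightarrow> complex mat" where
  "word_mat w = foldr (\<lambda>e A. arc_mat e * A) w (1\<^sub>m N)"

definition cycle_mat :: "'e list \<Rightarrow> complex mat" where
  "cycle_mat w = of_real (\<Prod>e\<leftarrow>w. q e) \<cdot>\<^sub>m hol G n U w"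

lemma arc_mat_carrier [simp]: "arc_mat e \<in> carrier_mat N N"
  unfolding arc_mat_def by (rule carrier_matI) (simp_all add: block_incl_def block_proj_def)

lemma transfer_mat_carrier [simp]: "transfer_mat \<in> carrier_mat N N"
  by (simp add: transfer_mat_def)

lemma word_mat_carrier [simp]: "word_mat w \<in> carrier_mat N N"
proof (induction w)
  case (Cons e w)
  then show ?case using mult_carrier_mat[OF arc_mat_carrier[of e] Cons] by (simp add: word_mat_def)
qed (simp add: word_mat_def)

lemma word_mat_Cons: "word_mat (e # w) = arc_mat e * word_mat w"
  by (simp add: word_mat_def)

lemma word_mat_append: "word_mat (u @ w) = word_mat u * word_mat w"
proof (induction u)
  case Nil
  then show ?case by (simp add: word_mat_def left_mult_one_mat[OF word_mat_carrier[unfolded word_mat_def]])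
next
  case (Cons e u)
  then show ?case
    using assoc_mult_mat[OF arc_mat_carrier[of e] word_mat_carrier[of u] word_mat_carrier[of w]]
    by (simp add: word_mat_Cons)
qed

lemma word_mat_concat_replicate: "word_mat (concat (replicate k w)) = word_mat w ^\<^sub>m k"
proof (induction k)
  case 0
  have "dim_row (word_mat w) = N" using word_mat_carrier[of w] by (rule carrier_matD)
  then show ?case by (simp add: word_mat_def)
next
  case (Suc k)
  then show ?case by (simp add: word_mat_append pow_mat_comm[OF word_mat_carrier])
qed

lemma mat_trace_word_mat_rotate: "mat_trace (word_mat (rotate m w)) = mat_trace (word_mat w)"
proof -
  define j where "j = m mod length w"
  have "mat_trace (word_mat (rotate m w)) = mat_trace (word_mat (drop j w) * word_mat (take j w))"
    by (simp add: rotate_drop_take j_def word_mat_append)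
  also have "\<dots> = mat_trace (word_mat (take j w) * word_mat (drop j w))"
    by (rule mat_trace_mult_comm[OF word_mat_carrier word_mat_carrier])
  also have "\<dots> = mat_trace (word_mat w)"
    by (simp add: word_mat_append[symmetric])
  finally show ?thesis .
qed

lemma finite_words: "finite {w. set w \<subseteq> arcs G \<and> length w = k}"
  by (rule finite_lists_length_eq) simp

lemma transfer_mat_pow_entry:
  assumes "a < N" "b < N"
  shows "(transfer_mat ^\<^sub>m k) $$ (a, b) = (\<Sum>w | set w \<subseteq> arcs G \<and> length w = k. word_mat w $$ (a, b))"
  using assms
proof (induction k arbitrary: a)
  case 0
  have "{w. set w \<subseteq> arcs G \<and> length w = 0} = {[]}" by auto
  moreover have "dim_row transfer_mat = N" by (simp add: transfer_mat_def)
  ultimately show ?case using 0 by (simp add: word_mat_def)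
next
  case (Suc k)
  let ?W = "\<lambda>k. {w. set w \<subseteq> arcs G \<and> length w = k}"
  have Tk: "transfer_mat ^\<^sub>m k \<in> carrier_mat N N" by simp
  have entry: "(A * B) $$ (a, b) = (\<Sum>c<N. A $$ (a, c) * B $$ (c, b))"
    if "A \<in> carrier_mat N N" "B \<in> carrier_mat N N" for A B :: "complex mat"
    by (rule index_mult_mat_sum[OF that Suc.prems])
  have "(transfer_mat ^\<^sub>m Suc k) $$ (a, b) = (transfer_mat * transfer_mat ^\<^sub>m k) $$ (a, b)"
    by (simp add: pow_mat_comm[OF transfer_mat_carrier])
  also have "\<dots> = (\<Sum>c<N. (\<Sum>e\<in>arcs G. arc_mat e $$ (a, c)) * (\<Sum>w\<in>?W k. word_mat w $$ (c, b)))"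
    using Suc.prems Suc.IH by (subst entry) (auto simp: Tk transfer_mat_def intro!: sum.cong)
  also have "\<dots> = (\<Sum>c<N. \<Sum>e\<in>arcs G. \<Sum>w\<in>?W k. arc_mat e $$ (a, c) * word_mat w $$ (c, b))"
    by (simp add: sum_product)
  also have "\<dots> = (\<Sum>e\<in>arcs G. \<Sum>w\<in>?W k. \<Sum>c<N. arc_mat e $$ (a, c) * word_mat w $$ (c, b))"
    by (subst sum.swap, intro sum.cong refl, rule sum.swap)
  also have "\<dots> = (\<Sum>e\<in>arcs G. \<Sum>w\<in>?W k. word_mat (e # w) $$ (a, b))"
    by (simp add: entry word_mat_Cons)
  also have "\<dots> = (\<Sum>(e, w)\<in>arcs G \<times> ?W k. word_mat (e # w) $$ (a, b))"
    by (rule sum.cartesian_product)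
  also have "\<dots> = (\<Sum>w\<in>?W (Suc k). word_mat w $$ (a, b))"
    by (rule sum.reindex_bij_witness[of _ "\<lambda>w. (hd w, tl w)" "\<lambda>(e, w). e # w"])
      (auto simp: length_Suc_conv)
  finally show ?case .
qed

lemma transfer_mat_mult_vec_block:
  assumes y: "y \<in> carrier_vec N" and v: "v \<in> verts G"
  shows "block_proj v *\<^sub>v (transfer_mat *\<^sub>v y) = vec (n v) (\<lambda>i. \<Sum>e | e \<in> arcs G \<and> tail G e = v.
    ((of_real (q e) \<cdot>\<^sub>m U e) *\<^sub>v (block_proj (head G e) *\<^sub>v y)) $ i)"
proof (rule eq_vecI)
  fix i
  assume "i < dim_vec (vec (n v) (\<lambda>i. \<Sum>e | e \<in> arcs G \<and> tail G e = v.
    ((of_real (q e) \<cdot>\<^sub>m U e) *\<^sub>v (block_proj (head G e) *\<^sub>v y)) $ i))"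
  then have i: "i < n v" by simp
  define a where "a = block_offset n v + i"
  have a: "a < N" unfolding a_def by (rule block_index_less_N[OF v i])
  have arc: "(arc_mat e *\<^sub>v y) $ a = (if tail G e = v
      then ((of_real (q e) \<cdot>\<^sub>m U e) *\<^sub>v (block_proj (head G e) *\<^sub>v y)) $ i else 0)"
    if e: "e \<in> arcs G" for e
  proof -
    let ?A = "complex_of_real (q e) \<cdot>\<^sub>m U e"
    define z where "z = ?A *\<^sub>v (block_proj (head G e) *\<^sub>v y)"
    have A: "?A \<in> carrier_mat (n (tail G e)) (n (head G e))" using U_carrier[OF e] by simp
    have Py: "block_proj (head G e) *\<^sub>v y \<in> carrier_vec (n (head G e))"
      by (rule mult_mat_vec_carrier[OF block_proj_carrier y])
    have z: "z \<in> carrier_vec (n (tail G e))"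
      unfolding z_def by (rule mult_mat_vec_carrier[OF A Py])
    have "arc_mat e *\<^sub>v y = (block_incl (tail G e) * ?A) *\<^sub>v (block_proj (head G e) *\<^sub>v y)"
      unfolding arc_mat_def
      by (rule assoc_mult_mat_vec[OF mult_carrier_mat[OF block_incl_carrier A] block_proj_carrier y])
    also have "\<dots> = block_incl (tail G e) *\<^sub>v z"
      unfolding z_def by (rule assoc_mult_mat_vec[OF block_incl_carrier A Py])
    finally have "(arc_mat e *\<^sub>v y) $ a = (block_incl (tail G e) *\<^sub>v z) $ a" by simp
    also have "\<dots> = (\<Sum>j<n (tail G e). block_incl (tail G e) $$ (a, j) * z $ j)"
      using z a by (auto simp: block_incl_def scalar_prod_def atLeast0LessThan intro!: sum.cong)
    also have "\<dots> = (\<Sum>j<n (tail G e). if tail G e = v \<and> j = i then z $ j else 0)"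
    proof (rule sum.cong[OF refl])
      fix j assume "j \<in> {..<n (tail G e)}"
      then have j: "j < n (tail G e)" by simp
      show "block_incl (tail G e) $$ (a, j) * z $ j = (if tail G e = v \<and> j = i then z $ j else 0)"
        using block_index_eq_iff[OF v _ i j] e a j by (auto simp: block_incl_def a_def)
    qed
    also have "\<dots> = (if tail G e = v then z $ i else 0)"
      using i by auto
    finally show ?thesis by (simp add: z_def)
  qed
  have "(block_proj v *\<^sub>v (transfer_mat *\<^sub>v y)) $ i = (transfer_mat *\<^sub>v y) $ a"
    unfolding a_def by (rule block_proj_mult_vec[OF v i mult_mat_vec_carrier[OF transfer_mat_carrier y]])
  also have "\<dots> = (\<Sum>b<N. (\<Sum>e\<in>arcs G. arc_mat e $$ (a, b)) * y $ b)"
    using a y by (auto simp: transfer_mat_def scalar_prod_def atLeast0LessThan intro!: sum.cong)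
  also have "\<dots> = (\<Sum>e\<in>arcs G. \<Sum>b<N. arc_mat e $$ (a, b) * y $ b)"
    by (subst sum.swap) (simp add: sum_distrib_right)
  also have "\<dots> = (\<Sum>e\<in>arcs G. (arc_mat e *\<^sub>v y) $ a)"
  proof (rule sum.cong[OF refl])
    fix e
    have "dim_row (arc_mat e) = N" "dim_col (arc_mat e) = N"
      using arc_mat_carrier[of e] by (rule carrier_matD)+
    then show "(\<Sum>b<N. arc_mat e $$ (a, b) * y $ b) = (arc_mat e *\<^sub>v y) $ a"
      using a y by (auto simp: scalar_prod_def atLeast0LessThan intro!: sum.cong)
  qed
  also have "\<dots> = (\<Sum>e | e \<in> arcs G \<and> tail G e = v.
      ((of_real (q e) \<cdot>\<^sub>m U e) *\<^sub>v (block_proj (head G e) *\<^sub>v y)) $ i)"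
    by (simp add: arc sum.If_cases Int_def cong: conj_cong)
  finally show "(block_proj v *\<^sub>v (transfer_mat *\<^sub>v y)) $ i = vec (n v) (\<lambda>i. \<Sum>e | e \<in> arcs G \<and> tail G e = v.
      ((of_real (q e) \<cdot>\<^sub>m U e) *\<^sub>v (block_proj (head G e) *\<^sub>v y)) $ i) $ i"
    using i by simp
qed (simp add: block_proj_def)

section \<open>Walks and traces of powers\<close>

definition walk :: "'e list \<Rightarrow> bool" where
  "walk w \<longleftrightarrow> set w \<subseteq> arcs G \<and> cas (tail G (hd w)) w (head G (last w))"

lemma walk_singleton [simp]: "walk [e] \<longleftrightarrow> e \<in> arcs G"
  by (simp add: walk_def)

lemma walk_Cons:
  "w \<noteq> [] \<Longrightarrow> walk (e # w) \<longleftrightarrow> e \<in> arcs G \<and> head G e = tail G (hd w) \<and> walk w"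
  by (cases w) (auto simp: walk_def)

lemma hol_singleton: "e \<in> arcs G \<Longrightarrow> hol G n U [e] = U e"
  using U_carrier[of e] by (simp add: hol_def)

lemma hol_Cons: "w \<noteq> [] \<Longrightarrow> hol G n U (e # w) = U e * hol G n U w"
  by (simp add: hol_def)

lemma cycle_mat_singleton: "e \<in> arcs G \<Longrightarrow> cycle_mat [e] = of_real (q e) \<cdot>\<^sub>m U e"
  by (simp add: cycle_mat_def hol_singleton)

lemma walk_hol_carrier:
  assumes "w \<noteq> []" "walk w"
  shows "hol G n U w \<in> carrier_mat (n (tail G (hd w))) (n (head G (last w)))"
  using assms
proof (induction w rule: list_nonempty_induct)
  case (single e)
  then show ?case using U_carrier by (simp add: hol_singleton)
next
  case (cons e w)
  then show ?case
    using U_carrier[of e] by (auto simp: hol_Cons walk_Cons intro!: mult_carrier_mat)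
qed

lemma cycle_mat_carrier:
  assumes "w \<noteq> []" "walk w"
  shows "cycle_mat w \<in> carrier_mat (n (tail G (hd w))) (n (head G (last w)))"
  using walk_hol_carrier[OF assms] by (simp add: cycle_mat_def)

lemma cycle_mat_Cons:
  assumes "w \<noteq> []" "walk (e # w)"
  shows "cycle_mat (e # w) = (of_real (q e) \<cdot>\<^sub>m U e) * cycle_mat w"
proof -
  have w: "walk w" "e \<in> arcs G" "head G e = tail G (hd w)" using assms by (auto simp: walk_Cons)
  note car = U_carrier[OF w(2), unfolded w(3)] walk_hol_carrier[OF assms(1) w(1)]
  let ?H = "hol G n U w" and ?r = "complex_of_real (\<Prod>e\<leftarrow>w. q e)"
  have "(of_real (q e) \<cdot>\<^sub>m U e) * cycle_mat w = of_real (q e) \<cdot>\<^sub>m (U e * (?r \<cdot>\<^sub>m ?H))"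
    unfolding cycle_mat_def by (rule mult_smult_assoc_mat[OF car(1) smult_carrier_mat[OF car(2)]])
  also have "U e * (?r \<cdot>\<^sub>m ?H) = ?r \<cdot>\<^sub>m (U e * ?H)"
    by (rule mult_smult_distrib[OF car])
  also have "of_real (q e) \<cdot>\<^sub>m (?r \<cdot>\<^sub>m (U e * ?H)) = (of_real (q e) * ?r) \<cdot>\<^sub>m (U e * ?H)"
    by (rule eq_matI) auto
  finally show ?thesis
    by (simp add: cycle_mat_def hol_Cons[OF assms(1)])
qed

lemma walk_ends:
  assumes "w \<noteq> []" "set w \<subseteq> arcs G"
  shows "tail G (hd w) \<in> verts G" "head G (last w) \<in> verts G"
  using assms by (auto simp: subset_iff)

text \<open>
  Between consecutive letters the projection onto one vertex meets the inclusion of another. Their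
  product is the identity if the letters fit together and zero otherwise.
\<close>

lemma word_mat_eq:
  assumes "w \<noteq> []" "set w \<subseteq> arcs G"
  shows "word_mat w = (if walk w
    then block_incl (tail G (hd w)) * cycle_mat w * block_proj (head G (last w)) else 0\<^sub>m N N)"
  using assms
proof (induction w rule: list_nonempty_induct)
  case (single e)
  then show ?case
    by (simp add: word_mat_def right_mult_one_mat[OF arc_mat_carrier] cycle_mat_singleton)
      (simp add: arc_mat_def)
next
  case (cons e w)
  have e: "e \<in> arcs G" and wG: "set w \<subseteq> arcs G" using cons.prems by auto
  note IH = cons.IH[OF wG]
  note ends = walk_ends[OF cons.hyps(1) wG]
  have he: "head G e \<in> verts G" using e by simp
  define I where "I = block_incl (tail G e)"
  define A where "A = complex_of_real (q e) \<cdot>\<^sub>m U e"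
  define P where "P = block_proj (head G e)"
  have car: "I \<in> carrier_mat N (n (tail G e))" "A \<in> carrier_mat (n (tail G e)) (n (head G e))"
    "P \<in> carrier_mat (n (head G e)) N"
    using U_carrier[OF e] by (auto simp: I_def A_def P_def)
  show ?case
  proof (cases "walk w")
    case False
    then show ?thesis
      using IH cons.hyps right_mult_zero_mat[OF arc_mat_carrier, of e N]
      by (simp add: word_mat_Cons walk_Cons)
  next
    case True
    define J where "J = block_incl (tail G (hd w))"
    define B where "B = cycle_mat w"
    define Q where "Q = block_proj (head G (last w))"
    have car': "J \<in> carrier_mat N (n (tail G (hd w)))"
      "B \<in> carrier_mat (n (tail G (hd w))) (n (head G (last w)))"
      "Q \<in> carrier_mat (n (head G (last w))) N"
      using cycle_mat_carrier[OF cons.hyps(1) True] by (auto simp: J_def B_def Q_def)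
    have PJ: "P * J = (if head G e = tail G (hd w) then 1\<^sub>m (n (head G e))
        else 0\<^sub>m (n (head G e)) (n (tail G (hd w))))"
      unfolding P_def J_def by (rule block_proj_mult_incl) (use he ends in auto)
    have "word_mat (e # w) = (I * A * P) * (J * B * Q)"
      using IH True by (simp add: word_mat_Cons arc_mat_def I_def A_def P_def J_def B_def Q_def)
    also have "\<dots> = I * (A * ((P * J) * (B * Q)))"
    proof -
      note c = car car' 
      have BQ: "B * Q \<in> carrier_mat (n (tail G (hd w))) N" using c by simp
      have "(I * A * P) * (J * B * Q) = (I * A * P) * (J * (B * Q))"
        using assoc_mult_mat[OF c(4,5,6)] by simp
      also have "\<dots> = (I * A) * (P * (J * (B * Q)))"
        by (rule assoc_mult_mat) (use c BQ in auto)
      also have "P * (J * (B * Q)) = P * J * (B * Q)"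
        by (rule assoc_mult_mat[symmetric]) (use c BQ in auto)
      also have "I * A * (P * J * (B * Q)) = I * (A * (P * J * (B * Q)))"
        by (rule assoc_mult_mat) (use c BQ in auto)
      finally show ?thesis .
    qed
    finally have eq: "word_mat (e # w) = I * (A * ((P * J) * (B * Q)))" .
    show ?thesis
    proof (cases "head G e = tail G (hd w)")
      case True
      have BQ: "B * Q \<in> carrier_mat (n (head G e)) N" using car' True by simp
      have "word_mat (e # w) = I * (A * (B * Q))"
        using eq PJ True left_mult_one_mat[OF BQ] by simp
      also have "A * (B * Q) = A * B * Q"
        by (rule assoc_mult_mat[symmetric]) (use car car' True in auto)
      also have "I * (A * B * Q) = I * (A * B) * Q"
        by (rule assoc_mult_mat[symmetric]) (use car car' True in auto)
      also have "A * B = cycle_mat (e # w)"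
        using cycle_mat_Cons[OF cons.hyps(1), of e] \<open>walk w\<close> True e cons.hyps(1)
        by (simp add: A_def B_def walk_Cons)
      finally show ?thesis
        using \<open>walk w\<close> True e cons.hyps(1) by (simp add: walk_Cons I_def Q_def)
    next
      case False
      have BQ: "B * Q \<in> carrier_mat (n (tail G (hd w))) N" using car' by simp
      have "P * J * (B * Q) = 0\<^sub>m (n (head G e)) N"
        using PJ False left_mult_zero_mat[OF BQ] by simp
      then have "word_mat (e # w) = I * (A * 0\<^sub>m (n (head G e)) N)" using eq by simp
      also have "\<dots> = 0\<^sub>m N N"
        using right_mult_zero_mat[OF car(2)] right_mult_zero_mat[OF car(1)] by simp
      finally show ?thesis using False cons.hyps(1) by (simp add: walk_Cons)
    qed
  qed
qed

lemma walk_nth: 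
  "walk w \<longleftrightarrow> set w \<subseteq> arcs G \<and> (\<forall>i. Suc i < length w \<longrightarrow> head G (w ! i) = tail G (w ! Suc i))" if "w \<noteq> []"
  using that
proof (induction w rule: list_nonempty_induct)
  case (cons e w)
  then show ?case
    by (auto simp: walk_Cons hd_conv_nth nth_Cons split: nat.splits)
qed simp

lemma closed_seqs_iff:
  "w \<in> closed_seqs G \<longleftrightarrow> w \<noteq> [] \<and> walk w \<and> head G (last w) = tail G (hd w)"
proof (cases "w = []")
  case False
  have "(\<forall>i<length w. head G (w ! i) = tail G (w ! ((i + 1) mod length w))) \<longleftrightarrow>
    (\<forall>i. Suc i < length w \<longrightarrow> head G (w ! i) = tail G (w ! Suc i)) \<and> head G (last w) = tail G (hd w)"
    (is "?L \<longleftrightarrow> ?R")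
  proof
    assume L: ?L
    show ?R
    proof (intro conjI allI impI)
      show "head G (w ! i) = tail G (w ! Suc i)" if "Suc i < length w" for i
        using L[rule_format, of i] that by simp
      show "head G (last w) = tail G (hd w)"
        using L[rule_format, of "length w - 1"] False by (simp add: last_conv_nth hd_conv_nth)
    qed
  next
    assume R: ?R
    show ?L
    proof (intro allI impI)
      fix i assume i: "i < length w"
      show "head G (w ! i) = tail G (w ! ((i + 1) mod length w))"
      proof (cases "Suc i < length w")
        case False
        then have "i = length w - 1" "Suc i = length w" using i by auto
        then show ?thesis using R \<open>w \<noteq> []\<close> by (simp add: last_conv_nth hd_conv_nth)
      qed (use R in simp)
    qed
  qed
  then show ?thesis using False walk_nth[OF False] by (auto simp: closed_seqs_def)
qed (simp add: closed_seqs_def)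

text \<open>
  Cyclicity of the trace brings the projection at the end of the walk next to the inclusion at its
  start, which gives zero unless the walk is closed.
\<close>

lemma mat_trace_word_mat:
  assumes "w \<noteq> []" "set w \<subseteq> arcs G"
  shows "mat_trace (word_mat w) = (if w \<in> closed_seqs G then mat_trace (cycle_mat w) else 0)"
proof (cases "walk w")
  case True
  let ?v = "tail G (hd w)" and ?v' = "head G (last w)"
  note ends = walk_ends[OF assms]
  note car = cycle_mat_carrier[OF assms(1) True]
  have "mat_trace (word_mat w) = mat_trace (block_incl ?v * cycle_mat w * block_proj ?v')"
    using word_mat_eq[OF assms] True by simp
  also have "\<dots> = mat_trace (block_proj ?v' * (block_incl ?v * cycle_mat w))"
    by (rule mat_trace_mult_comm[OF mult_carrier_mat[OF block_incl_carrier car] block_proj_carrier])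
  also have "block_proj ?v' * (block_incl ?v * cycle_mat w) = block_proj ?v' * block_incl ?v * cycle_mat w"
    by (rule assoc_mult_mat[OF block_proj_carrier block_incl_carrier car, symmetric])
  also have "\<dots> = (if ?v' = ?v then cycle_mat w else 0\<^sub>m (n ?v') (n ?v'))"
    using car block_proj_mult_incl[OF ends(2,1)]
    by (auto simp: left_mult_zero_mat[OF car] left_mult_one_mat[OF car])
  also have "mat_trace \<dots> = (if ?v' = ?v then mat_trace (cycle_mat w) else 0)"
    by (simp add: mat_trace_def)
  finally show ?thesis using True assms(1) by (simp add: closed_seqs_iff)
next
  case False
  then show ?thesis using word_mat_eq[OF assms] by (simp add: closed_seqs_iff mat_trace_def)
qed

lemma mat_trace_transfer_mat_pow:
  "mat_trace (transfer_mat ^\<^sub>m Suc k)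
    = (\<Sum>w | w \<in> closed_seqs G \<and> length w = Suc k. mat_trace (word_mat w))"
proof -
  let ?W = "{w. set w \<subseteq> arcs G \<and> length w = Suc k}"
  have "transfer_mat ^\<^sub>m Suc k \<in> carrier_mat N N"
    by (rule pow_carrier_mat) simp
  then have "mat_trace (transfer_mat ^\<^sub>m Suc k) = (\<Sum>a<N. (transfer_mat ^\<^sub>m Suc k) $$ (a, a))"
    unfolding mat_trace_def by (simp only: carrier_matD)
  also have "\<dots> = (\<Sum>a<N. \<Sum>w\<in>?W. word_mat w $$ (a, a))"
    by (intro sum.cong refl transfer_mat_pow_entry) auto
  also have "\<dots> = (\<Sum>w\<in>?W. mat_trace (word_mat w))"
  proof -
    have "dim_row (word_mat w) = N" for w using word_mat_carrier[of w] by (rule carrier_matD)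
    then show ?thesis by (subst sum.swap) (simp add: mat_trace_def)
  qed
  also have "\<dots> = (\<Sum>w | w \<in> closed_seqs G \<and> length w = Suc k. mat_trace (word_mat w))"
  proof (rule sum.mono_neutral_right[OF finite_words])
    show "{w. w \<in> closed_seqs G \<and> length w = Suc k} \<subseteq> ?W" by (auto simp: closed_seqs_def)
    show "\<forall>w\<in>?W - {w. w \<in> closed_seqs G \<and> length w = Suc k}. mat_trace (word_mat w) = 0"
    proof
      fix w assume w: "w \<in> ?W - {w. w \<in> closed_seqs G \<and> length w = Suc k}"
      then have "w \<noteq> []" "set w \<subseteq> arcs G" "w \<notin> closed_seqs G" by auto
      then show "mat_trace (word_mat w) = 0" using mat_trace_word_mat by simp
    qed
  qed
  finally show ?thesis .
qed

lemma cycle_mat_square: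
  assumes "w \<in> closed_seqs G"
  shows "cycle_mat w \<in> carrier_mat (n (tail G (hd w))) (n (tail G (hd w)))"
  using assms cycle_mat_carrier[of w] by (auto simp: closed_seqs_iff)

text \<open>
  Projecting after including is the identity, so in a power of \<open>I * B * P\<close> all inner factors
  \<open>P * I\<close> disappear.
\<close>

lemma mat_trace_word_mat_power:
  assumes w: "w \<in> closed_seqs G"
  shows "mat_trace (word_mat (concat (replicate (Suc k) w))) = mat_trace (cycle_mat w ^\<^sub>m Suc k)"
proof -
  let ?v = "tail G (hd w)"
  define I where "I = block_incl ?v"
  define P where "P = block_proj ?v"
  define B where "B = cycle_mat w"
  have ne: "w \<noteq> []" and wG: "set w \<subseteq> arcs G" and wk: "walk w" "head G (last w) = ?v"
    using w by (auto simp: closed_seqs_iff walk_def)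
  have car: "I \<in> carrier_mat N (n ?v)" "P \<in> carrier_mat (n ?v) N" "B \<in> carrier_mat (n ?v) (n ?v)"
    using cycle_mat_square[OF w] by (auto simp: I_def P_def B_def)
  have PI: "P * I = 1\<^sub>m (n ?v)"
    using block_proj_mult_incl[OF walk_ends(1)[OF ne wG] walk_ends(1)[OF ne wG]] by (simp add: P_def I_def)
  have W: "word_mat w = I * B * P"
    using word_mat_eq[OF ne wG] wk by (simp add: I_def P_def B_def)
  have "word_mat w ^\<^sub>m Suc k = I * B ^\<^sub>m Suc k * P"
  proof (induction k)
    case 0
    then show ?case using W word_mat_carrier[of w] car by simp
  next
    case (Suc k)
    define C where "C = B ^\<^sub>m Suc k"
    have C: "C \<in> carrier_mat (n ?v) (n ?v)" unfolding C_def by (rule pow_carrier_mat[OF car(3)])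
    have BP: "B * P \<in> carrier_mat (n ?v) N" using car by simp
    have "word_mat w ^\<^sub>m Suc (Suc k) = I * C * P * (I * B * P)"
      using Suc W by (simp add: C_def)
    also have "I * B * P = I * (B * P)" using car by simp
    also have "I * C * P * (I * (B * P)) = I * C * (P * (I * (B * P)))"
      by (rule assoc_mult_mat) (use car C BP in auto)
    also have "P * (I * (B * P)) = P * I * (B * P)"
      by (rule assoc_mult_mat[symmetric]) (use car BP in auto)
    also have "\<dots> = B * P" using PI left_mult_one_mat[OF BP] by simp
    also have "I * C * (B * P) = I * C * B * P"
      by (rule assoc_mult_mat[symmetric]) (use car C in auto)
    also have "I * C * B = I * (C * B)"
      by (rule assoc_mult_mat) (use car C in auto)
    also have "C * B = B ^\<^sub>m Suc (Suc k)" by (simp add: C_def)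
    finally show ?case .
  qed
  then have "mat_trace (word_mat (concat (replicate (Suc k) w))) = mat_trace (I * B ^\<^sub>m Suc k * P)"
    by (simp only: word_mat_concat_replicate)
  also have "\<dots> = mat_trace (P * (I * B ^\<^sub>m Suc k))"
    by (rule mat_trace_mult_comm) (use car in auto)
  also have "P * (I * B ^\<^sub>m Suc k) = P * I * B ^\<^sub>m Suc k"
    by (rule assoc_mult_mat[symmetric]) (use car in auto)
  also have "\<dots> = B ^\<^sub>m Suc k"
    using PI left_mult_one_mat[OF pow_carrier_mat[OF car(3), of "Suc k"]] by simp
  finally show ?thesis by (simp add: B_def)
qed

lemma closed_seqs_rotate:
  assumes "w \<in> closed_seqs G"
  shows "rotate m w \<in> closed_seqs G"
proof -
  define L where "L = length w"
  have L: "0 < L" using assms by (auto simp: closed_seqs_def L_def)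
  have adj: "head G (w ! i) = tail G (w ! ((i + 1) mod L))" if "i < L" for i
    using assms that by (auto simp: closed_seqs_def L_def)
  have "head G (rotate m w ! i) = tail G (rotate m w ! ((i + 1) mod L))" if i: "i < L" for i
  proof -
    have "head G (rotate m w ! i) = tail G (w ! (((m + i) mod L + 1) mod L))"
      using i L adj[of "(m + i) mod L"] by (simp add: nth_rotate L_def)
    also have "((m + i) mod L + 1) mod L = (m + (i + 1) mod L) mod L"
      by (simp add: mod_simps)
    also have "w ! \<dots> = rotate m w ! ((i + 1) mod L)"
      using L by (simp add: nth_rotate L_def)
    finally show ?thesis .
  qed
  then show ?thesis using assms by (auto simp: closed_seqs_def L_def)
qed

lemma closed_seqs_concat_replicate_iff:
  "concat (replicate (Suc k) u) \<in> closed_seqs G \<longleftrightarrow> u \<in> closed_seqs G"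
proof (cases "u = []")
  case True
  then show ?thesis by (simp add: closed_seqs_def)
next
  case False
  define L where "L = length u"
  define w where "w = concat (replicate (Suc k) u)"
  have L: "0 < L" using False by (simp add: L_def)
  have lw: "length w = Suc k * L" by (simp only: w_def length_concat_replicate L_def)
  have nth: "w ! i = u ! (i mod L)" if "i < Suc k * L" for i
    unfolding w_def L_def by (rule nth_concat_replicate) (use that L_def in simp)
  have step: "w ! ((i + 1) mod (Suc k * L)) = u ! ((i mod L + 1) mod L)" for i
  proof -
    have "w ! ((i + 1) mod (Suc k * L)) = u ! ((i + 1) mod (Suc k * L) mod L)"
      by (rule nth) (use L in simp)
    also have "(i + 1) mod (Suc k * L) mod L = (i mod L + 1) mod L"
      by (subst mod_mod_cancel) (simp_all add: mod_simps)
    finally show ?thesis .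
  qed
  have "(\<forall>i<Suc k * L. head G (w ! i) = tail G (w ! ((i + 1) mod (Suc k * L)))) \<longleftrightarrow>
      (\<forall>i<L. head G (u ! i) = tail G (u ! ((i + 1) mod L)))" (is "?A \<longleftrightarrow> ?B")
  proof
    assume A: ?A
    show ?B
    proof (intro allI impI)
      fix i assume i: "i < L"
      then have "i < Suc k * L" by (simp add: trans_less_add1)
      then show "head G (u ! i) = tail G (u ! ((i + 1) mod L))"
        using A[rule_format, of i] step[of i] nth[of i] i by simp
    qed
  next
    assume B: ?B
    show ?A
    proof (intro allI impI)
      fix i assume "i < Suc k * L"
      then show "head G (w ! i) = tail G (w ! ((i + 1) mod (Suc k * L)))"
        unfolding step using nth[of i] B[rule_format, of "i mod L"] L by simp
    qed
  qed
  moreover have "set w = set u" "w \<noteq> []" using False by (auto simp: w_def)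
  ultimately show ?thesis
    using False unfolding closed_seqs_def w_def[symmetric] by (simp add: lw L_def del: mult_Suc)
qed

end

section \<open>Norms\<close>

lemma vec_norm_zero: "vec_norm_on m \<nu> \<Longrightarrow> \<nu> (0\<^sub>v m) = 0"
  by (auto simp: vec_norm_on_def)

lemma vec_norm_smult: "vec_norm_on m \<nu> \<Longrightarrow> u \<in> carrier_vec m \<Longrightarrow> \<nu> (c \<cdot>\<^sub>v u) = cmod c * \<nu> u"
  by (auto simp: vec_norm_on_def)

lemma vec_norm_sum_le:
  assumes norm: "vec_norm_on m \<nu>" and "finite S" and "\<And>e. e \<in> S \<Longrightarrow> g e \<in> carrier_vec m"
  shows "\<nu> (vec m (\<lambda>i. \<Sum>e\<in>S. g e $ i)) \<le> (\<Sum>e\<in>S. \<nu> (g e))"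
  using assms(2,3)
proof (induction S rule: finite_induct)
  case empty
  have "vec m (\<lambda>i. \<Sum>e\<in>{}. g e $ i) = 0\<^sub>v m" by (rule eq_vecI) auto
  then show ?case using vec_norm_zero[OF norm] by simp
next
  case (insert e S)
  have "vec m (\<lambda>i. \<Sum>e\<in>insert e S. g e $ i) = g e + vec m (\<lambda>i. \<Sum>e\<in>S. g e $ i)"
    using insert.prems[of e] insert.hyps by (intro eq_vecI) auto
  also have "\<nu> \<dots> \<le> \<nu> (g e) + \<nu> (vec m (\<lambda>i. \<Sum>e\<in>S. g e $ i))"
    using norm insert.prems[of e] by (auto simp: vec_norm_on_def)
  finally show ?case using insert by fastforce
qed

lemma op_norm_le_1_contracts:
  assumes \<nu>: "vec_norm_on m \<nu>" and \<nu>': "vec_norm_on k \<nu>'" and A: "A \<in> carrier_mat k m"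
    and le: "op_norm m \<nu> \<nu>' A \<le> 1" and u: "u \<in> carrier_vec m"
  shows "\<nu>' (A *\<^sub>v u) \<le> \<nu> u"
proof (cases "u = 0\<^sub>v m")
  case True
  have "A *\<^sub>v 0\<^sub>v m = 0\<^sub>v k" using A by (intro eq_vecI) auto
  then show ?thesis using True vec_norm_zero[OF \<nu>] vec_norm_zero[OF \<nu>'] by simp
next
  case False
  then have pos: "0 < \<nu> u" using \<nu> u by (auto simp: vec_norm_on_def less_le)
  define u1 where "u1 = of_real (inverse (\<nu> u)) \<cdot>\<^sub>v u"
  have u1: "u1 \<in> carrier_vec m" using u by (simp add: u1_def)
  have "\<nu> u1 = 1" using vec_norm_smult[OF \<nu> u] pos by (simp add: u1_def norm_mult norm_inverse)
  then have "ereal (\<nu>' (A *\<^sub>v u1)) \<le> op_norm m \<nu> \<nu>' A"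
    unfolding op_norm_def using u1 by (intro SUP_upper) simp
  then have "ereal (\<nu>' (A *\<^sub>v u1)) \<le> 1" using le by (rule order_trans)
  then have "\<nu>' (A *\<^sub>v u1) \<le> 1" by simp
  moreover have "A *\<^sub>v u1 = of_real (inverse (\<nu> u)) \<cdot>\<^sub>v (A *\<^sub>v u)"
    unfolding u1_def by (rule mult_mat_vec[OF A u])
  moreover have "A *\<^sub>v u \<in> carrier_vec k" by (rule mult_mat_vec_carrier[OF A u])
  ultimately have "inverse (\<nu> u) * \<nu>' (A *\<^sub>v u) \<le> 1"
    using vec_norm_smult[OF \<nu>'] pos by (simp add: norm_mult norm_inverse)
  then show ?thesis using pos by (simp add: field_simps)
qed

section \<open>Substochastic weights\<close>

text \<open>
  Weights of a random walk that is killed with positive probability at some vertex reachable from any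
  given one. The condition \<open>leak\<close> is the abstract form of the assumption that every vertex is connected
  to one with positive \<open>\<kappa>\<close>.
\<close>

locale leaky_quiver = fin_digraph G
  for G :: "(nat, 'e) pre_digraph" +
  fixes q :: "'e \<Rightarrow> real"
  assumes q_nonneg: "e \<in> arcs G \<Longrightarrow> 0 \<le> q e"
    and substochastic: "v \<in> verts G \<Longrightarrow> (\<Sum>e | e \<in> arcs G \<and> tail G e = v. q e) \<le> 1"
    and leak: "v \<in> verts G \<Longrightarrow> \<exists>b\<in>verts G. (\<Sum>e | e \<in> arcs G \<and> tail G e = b. q e) < 1 \<and>
      (\<exists>es. awalk v es b \<and> (\<forall>e\<in>set es. 0 < q e))"
begin

text \<open>
  Maximum principle: where \<open>a\<close> attains a positive maximum, the outgoing weights sum to \<open>1\<close> and every arc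
  of positive weight leads to another point of maximum. Following arcs of positive weight to a vertex
  where mass is lost is then impossible.
\<close>

lemma subharmonic_eq_0:
  fixes a :: "nat \<Rightarrow> real"
  assumes nonneg: "\<And>v. v \<in> verts G \<Longrightarrow> 0 \<le> a v"
    and sub: "\<And>v. v \<in> verts G \<Longrightarrow> a v \<le> (\<Sum>e | e \<in> arcs G \<and> tail G e = v. q e * a (head G e))"
    and v: "v \<in> verts G"
  shows "a v = 0"
proof (rule ccontr)
  assume "a v \<noteq> 0"
  define m where "m = Max (a ` verts G)"
  have le_m: "a w \<le> m" if "w \<in> verts G" for w using that by (simp add: m_def)
  have m_pos: "0 < m" using le_m[OF v] nonneg[OF v] \<open>a v \<noteq> 0\<close> by linarith
  have "m \<in> a ` verts G" unfolding m_def using v by (intro Max_in) auto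
  then obtain w where w: "w \<in> verts G" "a w = m" by auto
  let ?out = "\<lambda>v. {e. e \<in> arcs G \<and> tail G e = v}"
  have fin: "finite (?out u)" for u by simp
  have sum_le: "m \<le> (\<Sum>e\<in>?out u. q e * a (head G e))" if "u \<in> verts G" "a u = m" for u
    using sub[OF that(1)] that by simp
  have tight: "(\<Sum>e\<in>?out u. q e) = 1" if "u \<in> verts G" "a u = m" for u
  proof -
    have "m \<le> (\<Sum>e\<in>?out u. q e * m)"
      by (rule order_trans[OF sum_le[OF that]]) (intro sum_mono mult_left_mono le_m q_nonneg, auto)
    then have "1 * m \<le> (\<Sum>e\<in>?out u. q e) * m" by (simp add: sum_distrib_right)
    then have "1 \<le> (\<Sum>e\<in>?out u. q e)" using m_pos by (simp add: mult_le_cancel_right)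
    then show ?thesis using substochastic[OF that(1)] by simp
  qed
  have step: "a (head G e) = m" if "e \<in> arcs G" "a (tail G e) = m" "0 < q e" for e
  proof (rule ccontr)
    assume "a (head G e) \<noteq> m"
    then have less: "q e * a (head G e) < q e * m"
      using le_m[of "head G e"] that by simp
    have "(\<Sum>e\<in>?out (tail G e). q e * a (head G e)) < (\<Sum>e\<in>?out (tail G e). q e * m)"
    proof (rule sum_strict_mono_ex1[OF fin])
      show "\<forall>e'\<in>?out (tail G e). q e' * a (head G e') \<le> q e' * m"
        by (auto intro!: mult_left_mono le_m q_nonneg)
      show "\<exists>e'\<in>?out (tail G e). q e' * a (head G e') < q e' * m"
        using less that(1) by blast
    qed
    also have "\<dots> = m" using tight[of "tail G e"] that by (simp add: sum_distrib_right[symmetric])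
    finally show False using sum_le[of "tail G e"] that by simp
  qed
  obtain b es where b: "b \<in> verts G" "(\<Sum>e\<in>?out b. q e) < 1"
      and es: "awalk w es b" "\<forall>e\<in>set es. 0 < q e"
    using leak[OF w(1)] by auto
  have "a b = m"
    using es w(2)
  proof (induction es arbitrary: w)
    case Nil
    then show ?case by (simp add: awalk_Nil_iff)
  next
    case (Cons e es)
    then have "e \<in> arcs G" "tail G e = w" "0 < q e" and rest: "awalk (head G e) es b"
      by (auto simp: awalk_Cons_iff)
    then have "a (head G e) = m" using step[of e] Cons.prems(3) by simp
    then show ?case using Cons.IH[OF rest] Cons.prems(2) by simp
  qed
  then show False using tight[OF b(1)] b(2) by simp
qed

end

section \<open>The Euler product for contractions\<close>

locale contractive_quiver = quiver_matrices G p n q U + leaky_quiver G q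
  for G :: "(nat, 'e) pre_digraph" and p n q U +
  fixes \<nu> :: "nat \<Rightarrow> complex vec \<Rightarrow> real"
  assumes norms: "v \<in> verts G \<Longrightarrow> vec_norm_on (n v) (\<nu> v)"
    and contraction: "e \<in> arcs G \<Longrightarrow> u \<in> carrier_vec (n (head G e)) \<Longrightarrow>
      \<nu> (tail G e) (U e *\<^sub>v u) \<le> \<nu> (head G e) u"
begin

lemma norm_nonneg: "v \<in> verts G \<Longrightarrow> u \<in> carrier_vec (n v) \<Longrightarrow> 0 \<le> \<nu> v u"
  and norm_eq_0_iff: "v \<in> verts G \<Longrightarrow> u \<in> carrier_vec (n v) \<Longrightarrow> \<nu> v u = 0 \<longleftrightarrow> u = 0\<^sub>v (n v)"
  using norms by (auto simp: vec_norm_on_def)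

lemma norm_weighted_arc:
  assumes "e \<in> arcs G" "u \<in> carrier_vec (n (head G e))"
  shows "\<nu> (tail G e) ((of_real (q e) \<cdot>\<^sub>m U e) *\<^sub>v u) \<le> q e * \<nu> (head G e) u"
proof -
  have eq: "(of_real (q e) \<cdot>\<^sub>m U e) *\<^sub>v u = of_real (q e) \<cdot>\<^sub>v (U e *\<^sub>v u)"
    using U_carrier[OF assms(1)] assms(2) by (intro eq_vecI) auto
  have car: "U e *\<^sub>v u \<in> carrier_vec (n (tail G e))"
    using U_carrier[OF assms(1)] assms(2) by simp
  have "\<nu> (tail G e) ((of_real (q e) \<cdot>\<^sub>m U e) *\<^sub>v u) = q e * \<nu> (tail G e) (U e *\<^sub>v u)"
    unfolding eq using vec_norm_smult[OF norms car] assms(1) q_nonneg by simp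
  also have "\<dots> \<le> q e * \<nu> (head G e) u"
    using contraction[OF assms] q_nonneg[OF assms(1)] by (rule mult_left_mono)
  finally show ?thesis .
qed

text \<open>
  If the eigenvalue had modulus at least \<open>1\<close>, the norms of the components of an eigenvector would be
  subharmonic.
\<close>

lemma eigenvalue_transfer_mat_less_1:
  assumes "eigenvalue transfer_mat l"
  shows "cmod l < 1"
proof (rule ccontr)
  assume "\<not> cmod l < 1"
  then have l: "1 \<le> cmod l" by simp
  have "dim_row transfer_mat = N" by (simp add: transfer_mat_def)
  then obtain y where y: "y \<in> carrier_vec N" "y \<noteq> 0\<^sub>v N" and ev: "transfer_mat *\<^sub>v y = l \<cdot>\<^sub>v y"
    using assms by (auto simp: eigenvalue_def eigenvector_def)
  define f where "f v = block_proj v *\<^sub>v y" for v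
  have f: "f v \<in> carrier_vec (n v)" for v
    unfolding f_def by (rule mult_mat_vec_carrier[OF block_proj_carrier y(1)])
  have lf: "l \<cdot>\<^sub>v f v = vec (n v) (\<lambda>i. \<Sum>e | e \<in> arcs G \<and> tail G e = v.
      ((of_real (q e) \<cdot>\<^sub>m U e) *\<^sub>v f (head G e)) $ i)" if v: "v \<in> verts G" for v
    using transfer_mat_mult_vec_block[OF y(1) v] mult_mat_vec[OF block_proj_carrier y(1), of v l]
    by (simp add: ev f_def)
  have zero: "\<nu> v (f v) = 0" if "v \<in> verts G" for v
    using _ _ that
  proof (rule subharmonic_eq_0)
    show "0 \<le> \<nu> v (f v)" if "v \<in> verts G" for v using norm_nonneg[OF that f] .
    show "\<nu> v (f v) \<le> (\<Sum>e | e \<in> arcs G \<and> tail G e = v. q e * \<nu> (head G e) (f (head G e)))"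
      if v: "v \<in> verts G" for v
    proof -
      have "\<nu> v (f v) \<le> cmod l * \<nu> v (f v)"
        using mult_right_mono[OF l norm_nonneg[OF v f]] by simp
      also have "\<dots> = \<nu> v (l \<cdot>\<^sub>v f v)" using vec_norm_smult[OF norms[OF v] f] by simp
      also have "\<dots> \<le> (\<Sum>e | e \<in> arcs G \<and> tail G e = v. \<nu> v ((of_real (q e) \<cdot>\<^sub>m U e) *\<^sub>v f (head G e)))"
        unfolding lf[OF v]
      proof (rule vec_norm_sum_le[OF norms[OF v]])
        fix e assume "e \<in> {e. e \<in> arcs G \<and> tail G e = v}"
        then have "U e \<in> carrier_mat (n v) (n (head G e))" using U_carrier[of e] by auto
        then show "(of_real (q e) \<cdot>\<^sub>m U e) *\<^sub>v f (head G e) \<in> carrier_vec (n v)"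
          by (intro mult_mat_vec_carrier[OF _ f] smult_carrier_mat)
      qed simp
      also have "\<dots> \<le> (\<Sum>e | e \<in> arcs G \<and> tail G e = v. q e * \<nu> (head G e) (f (head G e)))"
        by (rule sum_mono) (use norm_weighted_arc[OF _ f] in auto)
      finally show ?thesis .
    qed
  qed
  have "y = 0\<^sub>v N"
  proof (rule eq_vecI)
    fix a assume "a < dim_vec (0\<^sub>v N)"
    then have "a < N" by simp
    then obtain v i where v: "v \<in> verts G" "i < n v" "a = block_offset n v + i"
      by (rule block_index_cases)
    have "f v = 0\<^sub>v (n v)" using zero[OF v(1)] norm_eq_0_iff[OF v(1) f] by simp
    then have "f v $ i = 0" using v(2) by simp
    then show "y $ a = 0\<^sub>v N $ a"
      using block_proj_mult_vec[OF v(1,2) y(1)] v(3) \<open>a < N\<close> by (simp add: f_def)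
  qed (use y in simp)
  with y(2) show False by simp
qed

lemma weight_nonneg: "set w \<subseteq> arcs G \<Longrightarrow> 0 \<le> (\<Prod>e\<leftarrow>w. q e)"
  by (induction w) (auto intro!: mult_nonneg_nonneg q_nonneg)

lemma norm_cycle_mat_mult_vec:
  assumes "w \<noteq> []" "walk w" "u \<in> carrier_vec (n (head G (last w)))"
  shows "\<nu> (tail G (hd w)) (cycle_mat w *\<^sub>v u) \<le> (\<Prod>e\<leftarrow>w. q e) * \<nu> (head G (last w)) u"
  using assms
proof (induction w rule: list_nonempty_induct)
  case (single e)
  then show ?case using norm_weighted_arc[of e u] by (simp add: cycle_mat_singleton)
next
  case (cons e w)
  have w: "walk w" "e \<in> arcs G" "head G e = tail G (hd w)" and u: "u \<in> carrier_vec (n (head G (last w)))"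
    using cons.prems cons.hyps by (auto simp: walk_Cons)
  have W: "cycle_mat w \<in> carrier_mat (n (head G e)) (n (head G (last w)))"
    using cycle_mat_carrier[OF cons.hyps w(1)] w(3) by simp
  have U: "of_real (q e) \<cdot>\<^sub>m U e \<in> carrier_mat (n (tail G e)) (n (head G e))"
    using U_carrier[OF w(2)] by simp
  have "cycle_mat (e # w) *\<^sub>v u = (of_real (q e) \<cdot>\<^sub>m U e) *\<^sub>v (cycle_mat w *\<^sub>v u)"
    unfolding cycle_mat_Cons[OF cons.hyps cons.prems(1)] by (rule assoc_mult_mat_vec[OF U W u])
  also have "\<nu> (tail G e) \<dots> \<le> q e * \<nu> (head G e) (cycle_mat w *\<^sub>v u)"
    by (rule norm_weighted_arc[OF w(2) mult_mat_vec_carrier[OF W u]])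
  also have "\<dots> \<le> q e * ((\<Prod>e\<leftarrow>w. q e) * \<nu> (head G (last w)) u)"
    using cons.IH[OF w(1) u] q_nonneg[OF w(2)] w(3) by (intro mult_left_mono) simp_all
  finally show ?case using cons.hyps by (simp add: mult.assoc)
qed

lemma eigenvalue_cycle_mat_le:
  assumes w: "w \<in> closed_seqs G" and ev: "eigenvalue (cycle_mat w) l"
  shows "cmod l \<le> (\<Prod>e\<leftarrow>w. q e)"
proof -
  let ?v = "tail G (hd w)"
  have ne: "w \<noteq> []" and wk: "walk w" "head G (last w) = ?v" and wG: "set w \<subseteq> arcs G"
    using w by (auto simp: closed_seqs_iff walk_def)
  have v: "?v \<in> verts G" using walk_ends(1)[OF ne wG] .
  have "dim_row (cycle_mat w) = n ?v" using cycle_mat_square[OF w] by (rule carrier_matD)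
  then obtain u where u: "u \<in> carrier_vec (n ?v)" "u \<noteq> 0\<^sub>v (n ?v)" and lu: "cycle_mat w *\<^sub>v u = l \<cdot>\<^sub>v u"
    using ev by (auto simp: eigenvalue_def eigenvector_def)
  have "cmod l * \<nu> ?v u \<le> (\<Prod>e\<leftarrow>w. q e) * \<nu> ?v u"
    using norm_cycle_mat_mult_vec[OF ne wk(1), of u] vec_norm_smult[OF norms[OF v] u(1)] u(1)
    by (simp add: lu wk(2))
  moreover have "0 < \<nu> ?v u"
    using norm_nonneg[OF v u(1)] norm_eq_0_iff[OF v u(1)] u(2) by simp
  ultimately show ?thesis by simp
qed

lemma norm_mat_trace_word_mat_le:
  assumes w: "w \<in> closed_seqs G"
  shows "cmod (mat_trace (word_mat w)) \<le> real N * (\<Prod>e\<leftarrow>w. q e)"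
proof -
  let ?v = "tail G (hd w)"
  have ne: "w \<noteq> []" and wG: "set w \<subseteq> arcs G" using w by (auto simp: closed_seqs_def)
  have "n ?v \<le> N"
    using walk_ends(1)[OF ne wG] block_offset_Suc[of ?v n] block_offset_mono[of "Suc ?v" "Suc p" n]
    unfolding verts_eq N_def by simp
  have "cmod (mat_trace (cycle_mat w)) \<le> real (n ?v) * (\<Prod>e\<leftarrow>w. q e)"
    by (rule norm_mat_trace_le[OF cycle_mat_square[OF w] eigenvalue_cycle_mat_le[OF w]])
  also have "\<dots> \<le> real N * (\<Prod>e\<leftarrow>w. q e)"
    using \<open>n ?v \<le> N\<close> weight_nonneg[OF wG] by (intro mult_right_mono) simp_all
  finally show ?thesis using mat_trace_word_mat[OF ne wG] w by simp
qed

lemma vec_norm_on_1: "vec_norm_on 1 (\<lambda>u. cmod (u $ 0))"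
  unfolding vec_norm_on_def
proof (intro conjI ballI allI)
  fix u :: "complex vec" assume u: "u \<in> carrier_vec 1"
  show "(cmod (u $ 0) = 0) = (u = 0\<^sub>v 1)"
    using u by (auto intro!: eq_vecI)
qed (auto simp: norm_mult norm_triangle_ineq)

text \<open>
  Trivial matrices of size one turn the transfer matrix into the matrix of the weights themselves, so
  that results on traces become results on the weights of closed walks.
\<close>

lemma scalar_quiver: "contractive_quiver G p (\<lambda>_. 1) q (\<lambda>_. 1\<^sub>m 1) (\<lambda>_ u. cmod (u $ 0))"
proof unfold_locales
  show "vec_norm_on 1 (\<lambda>u. cmod (u $ 0))" by (rule vec_norm_on_1)
qed (auto simp: verts_eq)

lemma mat_trace_scalar_word_mat:
  assumes w: "w \<in> closed_seqs G"
  shows "mat_trace (quiver_matrices.word_mat G p (\<lambda>_. 1) q (\<lambda>_. 1\<^sub>m 1) w) = of_real (\<Prod>e\<leftarrow>w. q e)"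
proof -
  interpret scalar: contractive_quiver G p "\<lambda>_. 1" q "\<lambda>_. 1\<^sub>m 1" "\<lambda>_ u. cmod (u $ 0)"
    by (rule scalar_quiver)
  have ne: "w \<noteq> []" and wG: "set w \<subseteq> arcs G" using w by (auto simp: closed_seqs_def)
  have hol1: "hol G (\<lambda>_. 1) (\<lambda>_. 1\<^sub>m 1) w = (1\<^sub>m 1 :: complex mat)"
    unfolding hol_def by (induction w) auto
  have "mat_trace (scalar.word_mat w) = mat_trace (scalar.cycle_mat w)"
    using scalar.mat_trace_word_mat[OF ne wG] w by simp
  also have "\<dots> = of_real (\<Prod>e\<leftarrow>w. q e)"
    unfolding scalar.cycle_mat_def hol1 by (simp add: mat_trace_def)
  finally show ?thesis .
qed

text \<open>
  A finite set of closed walks has bounded length \<open>K\<close>, so its total weight is at most the sum of the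
  first \<open>K\<close> power traces of the matrix of weights, which form a convergent series.
\<close>

lemma summable_cycle_weights: "(\<lambda>w. \<Prod>e\<leftarrow>w. q e) summable_on closed_seqs G"
proof (rule nonneg_bdd_above_summable_on)
  interpret scalar: contractive_quiver G p "\<lambda>_. 1" q "\<lambda>_. 1\<^sub>m 1" "\<lambda>_ u. cmod (u $ 0)"
    by (rule scalar_quiver)
  define T where "T = scalar.transfer_mat"
  define W where "W k = {w. w \<in> closed_seqs G \<and> length w = Suc k}" for k
  have nonneg: "0 \<le> (\<Prod>e\<leftarrow>w. q e)" if "w \<in> closed_seqs G" for w
    using that by (intro weight_nonneg) (auto simp: closed_seqs_def)
  then show "0 \<le> (\<Prod>e\<leftarrow>w. q e)" if "w \<in> closed_seqs G" for w using that .
  have finW: "finite (W k)" for k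
    by (rule finite_subset[OF _ finite_words[of "Suc k"]]) (auto simp: W_def closed_seqs_def)
  have trace: "mat_trace (T ^\<^sub>m Suc k) = of_real (\<Sum>w\<in>W k. \<Prod>e\<leftarrow>w. q e)" for k
    unfolding T_def scalar.mat_trace_transfer_mat_pow W_def of_real_sum
    by (rule sum.cong[OF refl]) (use mat_trace_scalar_word_mat in auto)
  have "summable (\<lambda>k. cmod (mat_trace (T ^\<^sub>m k)))"
    unfolding T_def
    by (rule summable_mat_trace_pow[OF scalar.transfer_mat_carrier scalar.eigenvalue_transfer_mat_less_1])
  then have summ: "summable (\<lambda>k. cmod (mat_trace (T ^\<^sub>m Suc k)))"
    by (subst summable_Suc_iff)
  show "bdd_above (sum (\<lambda>w. \<Prod>e\<leftarrow>w. q e) ` {F. F \<subseteq> closed_seqs G \<and> finite F})"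
  proof (rule bdd_aboveI2)
    fix F assume "F \<in> {F. F \<subseteq> closed_seqs G \<and> finite F}"
    then have F: "F \<subseteq> closed_seqs G" "finite F" by auto
    define K where "K = Max (insert 0 (length ` F))"
    have sub: "F \<subseteq> (\<Union>k\<in>{..<K}. W k)"
    proof
      fix w assume w: "w \<in> F"
      then have "length w \<le> K" unfolding K_def using F(2) by (intro Max_ge) auto
      moreover have "w \<noteq> []" "w \<in> closed_seqs G" using w F by (auto simp: closed_seqs_def)
      ultimately have "length w - 1 < K" "w \<in> W (length w - 1)"
        by (cases w; simp add: W_def)+
      then show "w \<in> (\<Union>k\<in>{..<K}. W k)" by blast
    qed
    have "(\<Sum>w\<in>F. \<Prod>e\<leftarrow>w. q e) \<le> (\<Sum>w\<in>(\<Union>k\<in>{..<K}. W k). \<Prod>e\<leftarrow>w. q e)"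
      by (rule sum_mono2[OF _ sub]) (use finW nonneg in \<open>auto simp: W_def\<close>)
    also have "\<dots> = (\<Sum>k<K. \<Sum>w\<in>W k. \<Prod>e\<leftarrow>w. q e)"
      by (rule sum.UNION_disjoint) (use finW in \<open>auto simp: W_def\<close>)
    also have "\<dots> \<le> (\<Sum>k<K. cmod (mat_trace (T ^\<^sub>m Suc k)))"
      unfolding trace by (intro sum_mono) (simp del: of_real_sum)
    also have "\<dots> \<le> (\<Sum>k. cmod (mat_trace (T ^\<^sub>m Suc k)))"
      by (rule sum_le_suminf[OF summ]) auto
    finally show "(\<Sum>w\<in>F. \<Prod>e\<leftarrow>w. q e) \<le> (\<Sum>k. cmod (mat_trace (T ^\<^sub>m Suc k)))" .
  qed
qed

text \<open>
  The powers of a closed walk of weight at least \<open>1\<close> would be infinitely many closed walks of weight at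
  least \<open>1\<close>, contradicting summability.
\<close>

lemma cycle_weight_less_1:
  assumes w: "w \<in> closed_seqs G"
  shows "(\<Prod>e\<leftarrow>w. q e) < 1"
proof (rule ccontr)
  assume "\<not> ?thesis"
  then have ge: "1 \<le> (\<Prod>e\<leftarrow>w. q e)" by simp
  have weight_pow: "(\<Prod>e\<leftarrow>concat (replicate k w). q e) = (\<Prod>e\<leftarrow>w. q e) ^ k" for k
    by (induction k) auto
  have ne: "w \<noteq> []" using w by (auto simp: closed_seqs_def)
  have inj: "inj (\<lambda>k. concat (replicate (Suc k) w))"
  proof (rule injI)
    fix k l assume "concat (replicate (Suc k) w) = concat (replicate (Suc l) w)"
    then have "Suc k * length w = Suc l * length w" by (metis length_concat_replicate)
    then show "k = l" using ne by (simp del: mult_Suc)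
  qed
  have "(\<lambda>w. \<Prod>e\<leftarrow>w. q e) summable_on range (\<lambda>k. concat (replicate (Suc k) w))"
    by (rule summable_on_subset_banach[OF summable_cycle_weights])
      (use w closed_seqs_concat_replicate_iff in blast)
  then have "(\<lambda>k. (\<Prod>e\<leftarrow>w. q e) ^ Suc k) summable_on UNIV"
    by (subst (asm) summable_on_reindex[OF inj]) (simp only: o_def weight_pow)
  then have "(\<lambda>k. (\<Prod>e\<leftarrow>w. q e) ^ Suc k) \<longlonglongrightarrow> 0"
    by (intro summable_LIMSEQ_zero summable_on_imp_summable)
  moreover have "1 \<le> (\<Prod>e\<leftarrow>w. q e) ^ Suc k" for k using ge by (rule one_le_power)
  ultimately have "(1::real) \<le> 0" by (intro LIMSEQ_le_const) auto
  then show False by simp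
qed

text \<open>
  Both sides are exponentials of minus a sum of \<open>F w / length w\<close> over closed walks: grouped
  by length on the left, by the class of the primitive root on the right.
\<close>

theorem det_one_minus_transfer_mat:
  shows "abs_convergent_prod_on (cycle_factor G n q U) (prime_cycles G)"
    and "det (1\<^sub>m N - transfer_mat) = infprod (cycle_factor G n q U) (prime_cycles G)"
proof -
  define F where "F w = mat_trace (word_mat w)" for w
  define S where "S c = (\<Sum>\<^sub>\<infinity>k. F (concat (replicate (Suc k) (cycle_rep c))) / of_nat (Suc k))" for c
  have C: "prime_cycles G = {c \<in> closed_seqs G // cyclic_perm. valuation c = 1}"
    by (simp add: prime_cycles_def quiver_cycles_def)
  have absF: "F abs_summable_on closed_seqs G"
  proof (rule abs_summable_on_comparison_test')
    show "(\<lambda>w. real N * (\<Prod>e\<leftarrow>w. q e)) summable_on closed_seqs G"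
      by (intro summable_on_cmult_right summable_cycle_weights)
  qed (simp add: F_def norm_mat_trace_word_mat_le)
  have "[] \<notin> closed_seqs G" by (simp add: closed_seqs_def)
  note words = sum_over_words_eq_sum_over_primitive_classes[OF this closed_seqs_rotate
      closed_seqs_concat_replicate_iff _ absF, folded C S_def]
  have Frot: "F (rotate m w) = F w" for m w by (simp add: F_def mat_trace_word_mat_rotate)
  have absS: "S abs_summable_on prime_cycles G"
    and sumS: "(\<Sum>\<^sub>\<infinity>c\<in>prime_cycles G. S c) = (\<Sum>\<^sub>\<infinity>w\<in>closed_seqs G. F w / of_nat (length w))"
    using words Frot by blast+
  have factor: "cycle_factor G n q U c = exp (- S c)" if "c \<in> prime_cycles G" for c
  proof -
    have w: "cycle_rep c \<in> closed_seqs G"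
      using that cyclic_class(1,2)[OF _ closed_seqs_rotate] unfolding C by blast
    have lt: "cmod l < 1" if "eigenvalue (cycle_mat (cycle_rep c)) l" for l
      using eigenvalue_cycle_mat_le[OF w that] cycle_weight_less_1[OF w] by linarith
    have "cycle_factor G n q U c
        = det (1\<^sub>m (n (tail G (hd (cycle_rep c)))) - cycle_mat (cycle_rep c))"
      by (simp add: cycle_factor_def Let_def cycle_mat_def)
    also have "\<dots> = exp (- S c)"
      unfolding S_def F_def mat_trace_word_mat_power[OF w]
      by (rule det_one_minus_eq_exp_traces[OF cycle_mat_square[OF w] lt])
    finally show ?thesis .
  qed
  have absS': "(\<lambda>c. - S c) abs_summable_on prime_cycles G" using absS by simp
  show "abs_convergent_prod_on (cycle_factor G n q U) (prime_cycles G)"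
    by (rule infprod_exp(1)[OF absS' factor])
  define W where "W k = {w. w \<in> closed_seqs G \<and> length w = Suc k}" for k
  have finW: "finite (W k)" for k
    by (rule finite_subset[OF _ finite_words[of "Suc k"]]) (auto simp: W_def closed_seqs_def)
  have bij: "bij_betw snd (SIGMA k:UNIV. W k) (closed_seqs G)"
    by (rule bij_betwI[of _ _ _ "\<lambda>w. (length w - 1, w)"]) (auto simp: W_def closed_seqs_def)
  have abs: "(\<lambda>t. F (snd t) / of_nat (length (snd t))) abs_summable_on (SIGMA k:UNIV. W k)"
    using abs_summable_on_divide_length[OF absF]
      summable_on_reindex_bij_betw[OF bij, of "\<lambda>w. cmod (F w / of_nat (length w))"] by simp
  have trace: "mat_trace (transfer_mat ^\<^sub>m Suc k) / of_nat (Suc k)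
      = (\<Sum>\<^sub>\<infinity>w\<in>W k. F w / of_nat (length w))" for k
    unfolding mat_trace_transfer_mat_pow infsum_finite[OF finW] sum_divide_distrib
    by (rule sum.cong) (auto simp: W_def F_def)
  have "det (1\<^sub>m N - transfer_mat) = exp (- (\<Sum>\<^sub>\<infinity>k. mat_trace (transfer_mat ^\<^sub>m Suc k) / of_nat (Suc k)))"
    by (rule det_one_minus_eq_exp_traces[OF transfer_mat_carrier eigenvalue_transfer_mat_less_1])
  also have "(\<Sum>\<^sub>\<infinity>k. mat_trace (transfer_mat ^\<^sub>m Suc k) / of_nat (Suc k))
      = (\<Sum>\<^sub>\<infinity>t\<in>(SIGMA k:UNIV. W k). F (snd t) / of_nat (length (snd t)))"
    using infsum_Sigma_banach[OF abs_summable_summable[OF abs]] by (simp only: trace snd_conv)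
  also have "\<dots> = (\<Sum>\<^sub>\<infinity>w\<in>closed_seqs G. F w / of_nat (length w))"
    by (rule infsum_reindex_bij_betw[OF bij])
  also have "exp (- \<dots>) = exp (\<Sum>\<^sub>\<infinity>c\<in>prime_cycles G. - S c)"
    by (simp add: sumS[symmetric] infsum_uminus)
  also have "\<dots> = infprod (cycle_factor G n q U) (prime_cycles G)"
    by (rule infprod_exp(2)[OF absS' factor, symmetric])
  finally show "det (1\<^sub>m N - transfer_mat) = infprod (cycle_factor G n q U) (prime_cycles G)" .
qed

end

section \<open>The Laplacian in coordinates\<close>

lemma flatten_upt:
  fixes f :: "nat \<Rightarrow> complex vec"
  assumes f: "\<And>v. f v \<in> carrier_vec (n v)"
  shows "dim_vec (foldr (\<lambda>v w. f v @\<^sub>v w) [l..<r] vNil) = (\<Sum>u\<in>{l..<r}. n u)"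
    and "l \<le> v \<Longrightarrow> v < r \<Longrightarrow> i < n v \<Longrightarrow>
      foldr (\<lambda>v w. f v @\<^sub>v w) [l..<r] vNil $ ((\<Sum>u\<in>{l..<v}. n u) + i) = f v $ i"
proof (induction "r - l" arbitrary: l)
  case 0
  {
    case 1
    then show ?case using 0 by simp
  next
    case 2
    then show ?case using 0 by simp
  }
next
  case (Suc d)
  have l: "l < r" "d = r - Suc l" using Suc.hyps(3) by auto
  note IH = Suc.hyps(1,2)[OF l(2)]
  have upt: "[l..<r] = l # [Suc l..<r]" using l(1) by (rule upt_conv_Cons)
  have dim: "dim_vec (f l) = n l" using f[of l] by simp
  have split: "(\<Sum>u\<in>{l..<m}. n u) = n l + (\<Sum>u\<in>{Suc l..<m}. n u)" if "l < m" for m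
    using that by (rule sum.atLeast_Suc_lessThan)
  {
    case 1
    show ?case using IH(1) split[OF l(1)] by (simp add: upt dim)
  next
    case 2
    show ?case
    proof (cases "v = l")
      case True
      then show ?thesis using 2 dim by (simp add: upt)
    next
      case False
      then have v: "Suc l \<le> v" "l < v" using 2 by auto
      have "(\<Sum>u\<in>{Suc l..<v}. n u) + i < (\<Sum>u\<in>{Suc l..<r}. n u)"
      proof -
        have "(\<Sum>u\<in>{Suc l..<Suc v}. n u) \<le> (\<Sum>u\<in>{Suc l..<r}. n u)"
          using 2 by (intro sum_mono2) auto
        then show ?thesis using v 2 by simp
      qed
      then show ?thesis
        using IH(2)[OF v(1)] 2 by (simp add: upt dim split[OF v(2)] IH(1))
    qed
  }
qed

lemma diag_block_scalar_upt:
  fixes c :: "nat \<Rightarrow> complex" and n :: "nat \<Rightarrow> nat"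
  defines "D \<equiv> \<lambda>l r. diag_block_mat (map (\<lambda>a. c a \<cdot>\<^sub>m 1\<^sub>m (n a)) [l..<r])"
  shows "D l r \<in> carrier_mat (\<Sum>u\<in>{l..<r}. n u) (\<Sum>u\<in>{l..<r}. n u)"
    and "det (D l r) = (\<Prod>u\<in>{l..<r}. c u ^ n u)"
    and "l \<le> v \<Longrightarrow> v < r \<Longrightarrow> i < n v \<Longrightarrow> j < (\<Sum>u\<in>{l..<r}. n u) \<Longrightarrow>
      D l r $$ ((\<Sum>u\<in>{l..<v}. n u) + i, j) = (if j = (\<Sum>u\<in>{l..<v}. n u) + i then c v else 0)"
proof (induction "r - l" arbitrary: l j)
  case 0
  {
    case 1
    then show ?case using 0 by (simp add: D_def)
  next
    case 2
    then show ?case using 0 by (simp add: D_def)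
  next
    case 3
    then show ?case using 0 by simp
  }
next
  case (Suc d)
  have l: "l < r" "d = r - Suc l" using Suc.hyps(4) by auto
  note IH = Suc.hyps(1-3)[OF l(2)]
  let ?N = "\<Sum>u\<in>{Suc l..<r}. n u"
  have dims: "dim_row (D (Suc l) r) = ?N" "dim_col (D (Suc l) r) = ?N"
    using IH(1) by auto
  have D: "D l r = four_block_mat (c l \<cdot>\<^sub>m 1\<^sub>m (n l)) (0\<^sub>m (n l) ?N) (0\<^sub>m ?N (n l)) (D (Suc l) r)"
    using dims unfolding D_def upt_conv_Cons[OF l(1)] by (simp add: Let_def)
  have split: "(\<Sum>u\<in>{l..<m}. n u) = n l + (\<Sum>u\<in>{Suc l..<m}. n u)" if "l < m" for m
    using that by (rule sum.atLeast_Suc_lessThan)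
  {
    case 1
    show ?case unfolding D split[OF l(1)]
      by (rule four_block_carrier_mat[OF _ IH(1)]) simp
  next
    case 2
    have "det (D l r) = det (c l \<cdot>\<^sub>m 1\<^sub>m (n l)) * det (D (Suc l) r)"
      unfolding D by (rule det_four_block_mat_lower_left_zero[OF _ _ _ IH(1)]) auto
    then show ?case
      using IH(2) prod.atLeast_Suc_lessThan[OF l(1), of "\<lambda>u. c u ^ n u"] by simp
  next
    case 3
    show ?case
    proof (cases "v = l")
      case True
      then show ?thesis using 3 dims by (auto simp: D split[OF l(1)])
    next
      case False
      then have v: "Suc l \<le> v" "l < v" using 3 by auto
      have less: "(\<Sum>u\<in>{Suc l..<v}. n u) + i < ?N"
      proof -
        have "(\<Sum>u\<in>{Suc l..<Suc v}. n u) \<le> ?N"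
          using 3 by (intro sum_mono2) auto
        then show ?thesis using v 3 by simp
      qed
      show ?thesis
      proof (cases "j < n l")
        case True
        then show ?thesis using less by (simp add: D dims split[OF v(2)])
      next
        case False
        then have "j - n l < ?N" using 3 split[OF l(1)] by simp
        then show ?thesis
          using IH(3)[OF v(1), of "j - n l"] 3 less False
          by (auto simp: D dims split[OF v(2)])
      qed
    qed
  }
qed

context quiver_matrices
begin

lemma finsum_laplacian_carrier:
  assumes f: "\<And>u. f u \<in> carrier_vec (n u)"
  shows "(\<lambda>e. complex_of_real (x e) \<cdot>\<^sub>v (f (tail G e) - U e *\<^sub>v f (head G e)))
    \<in> {e \<in> arcs G. tail G e = v} \<rightarrow> carrier_vec (n v)"
proof
  fix e assume "e \<in> {e \<in> arcs G. tail G e = v}"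
  then have "U e \<in> carrier_mat (n v) (n (head G e))" "tail G e = v" using U_carrier[of e] by auto
  then show "complex_of_real (x e) \<cdot>\<^sub>v (f (tail G e) - U e *\<^sub>v f (head G e)) \<in> carrier_vec (n v)"
    using f mult_mat_vec_carrier[of "U e" "n v" "n (head G e)" "f (head G e)"] by auto
qed

lemma twisted_laplacian_index:
  assumes f: "\<And>u. f u \<in> carrier_vec (n u)" and i: "i < n v"
  shows "twisted_laplacian G n x U f v $ i
    = of_real (out_weight G x v) * f v $ i
      - (\<Sum>e | e \<in> arcs G \<and> tail G e = v. of_real (x e) * (U e *\<^sub>v f (head G e)) $ i)"
proof -
  have "twisted_laplacian G n x U f v $ i = (\<Sum>e | e \<in> arcs G \<and> tail G e = v.
      (complex_of_real (x e) \<cdot>\<^sub>v (f (tail G e) - U e *\<^sub>v f (head G e))) $ i)"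
    unfolding twisted_laplacian_def
    by (rule index_finsum_vec[OF _ i finsum_laplacian_carrier[OF f]]) simp
  also have "\<dots> = (\<Sum>e | e \<in> arcs G \<and> tail G e = v.
      of_real (x e) * f v $ i - of_real (x e) * (U e *\<^sub>v f (head G e)) $ i)"
  proof (rule sum.cong[OF refl])
    fix e assume "e \<in> {e. e \<in> arcs G \<and> tail G e = v}"
    then have e: "U e \<in> carrier_mat (n v) (n (head G e))" "tail G e = v" using U_carrier[of e] by auto
    have "dim_vec (U e *\<^sub>v f (head G e)) = n v" using e(1) by simp
    moreover have "dim_vec (f v) = n v" using f[of v] by simp
    ultimately show "(complex_of_real (x e) \<cdot>\<^sub>v (f (tail G e) - U e *\<^sub>v f (head G e))) $ i
        = of_real (x e) * f v $ i - of_real (x e) * (U e *\<^sub>v f (head G e)) $ i"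
      using i e(2) by (simp add: right_diff_distrib)
  qed
  finally show ?thesis
    by (simp add: sum_subtractf sum_distrib_right out_weight_def)
qed

text \<open>
  Row \<open>(v, i)\<close> of the left-hand side is \<open>\<kappa> v + z v\<close> times the unit row minus the rows of the matrices
  \<open>x e \<cdot> U e\<close> for the arcs \<open>e\<close> leaving \<open>v\<close>. As \<open>x e = (z v + \<kappa> v) \<cdot> q e\<close> for these arcs, \<open>z v + \<kappa> v\<close> is a
  common factor.
\<close>

lemma laplacian_matrix:
  fixes x :: "'e \<Rightarrow> real" and \<kappa> :: "nat \<Rightarrow> real"
  defines "z \<equiv> out_weight G x"
  assumes q: "\<And>e. e \<in> arcs G \<Longrightarrow> (z (tail G e) + \<kappa> (tail G e)) * q e = x e"
  shows "diag_block_mat (map (\<lambda>a. complex_of_real (\<kappa> a) \<cdot>\<^sub>m 1\<^sub>m (n a)) [1..<Suc p])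
      + endo_mat n p (twisted_laplacian G n x U)
    = diag_block_mat (map (\<lambda>a. complex_of_real (z a + \<kappa> a) \<cdot>\<^sub>m 1\<^sub>m (n a)) [1..<Suc p])
      * (1\<^sub>m N - transfer_mat)" (is "?K + ?L = ?D * ?M")
proof (rule eq_matI)
  have N_eq: "N = (\<Sum>u\<in>{1..<Suc p}. n u)" by (simp add: N_def block_offset_def)
  have K: "?K \<in> carrier_mat N N" and D: "?D \<in> carrier_mat N N"
    unfolding N_eq by (rule diag_block_scalar_upt(1))+
  have M: "?M \<in> carrier_mat N N" by (rule minus_carrier_mat[OF transfer_mat_carrier])
  have len: "(\<Sum>v\<in>{1..p}. n v) = N" unfolding N_eq by (rule sum.cong) auto
  have L: "?L \<in> carrier_mat N N"
    unfolding endo_mat_def Let_def len by (rule carrier_matI) simp_all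
  have KL: "?K + ?L \<in> carrier_mat N N" by (rule add_carrier_mat[OF L])
  have DM: "?D * ?M \<in> carrier_mat N N" by (rule mult_carrier_mat[OF D M])
  show "dim_row (?K + ?L) = dim_row (?D * ?M)" "dim_col (?K + ?L) = dim_col (?D * ?M)"
    by (simp_all only: carrier_matD[OF KL] carrier_matD[OF DM])
  fix a b assume "a < dim_row (?D * ?M)" "b < dim_col (?D * ?M)"
  then have a: "a < N" and b: "b < N"
    by (simp_all only: carrier_matD[OF DM])
  obtain v i where v: "v \<in> verts G" and i: "i < n v" and av: "a = block_offset n v + i"
    using a by (rule block_index_cases)
  have v': "1 \<le> v" "v < Suc p" using v verts_eq by auto
  define d :: complex where "d = (if b = a then 1 else 0)"
  \<comment> \<open>The family of components of the basis vector whose image is column \<open>b\<close> of the matrix.\<close>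
  define f where "f = unflatten n (unit_vec N b)"
  have f: "f u \<in> carrier_vec (n u)" for u by (simp add: f_def unflatten_def)
  have f_eq: "block_proj u *\<^sub>v unit_vec N b = f u" if "u \<in> verts G" for u
  proof (rule eq_vecI)
    fix j assume "j < dim_vec (f u)"
    then have j: "j < n u" using f[of u] by simp
    show "(block_proj u *\<^sub>v unit_vec N b) $ j = f u $ j"
      using block_proj_mult_vec[OF that j, of "unit_vec N b"] j
      by (simp add: f_def unflatten_def block_offset_def)
  qed (use f[of u] in \<open>simp add: block_proj_def\<close>)
  have fvi: "f v $ i = d"
    using i a b by (simp add: f_def unflatten_def d_def av block_offset_def)
  have diag: "diag_block_mat (map (\<lambda>a. c a \<cdot>\<^sub>m 1\<^sub>m (n a)) [1..<Suc p]) $$ (a, k)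
      = (if k = a then c v else 0)" if "k < N" for k and c :: "nat \<Rightarrow> complex"
    unfolding av block_offset_def
    by (rule diag_block_scalar_upt(3)[where n = n and v = v and i = i, OF v' i that[unfolded N_eq]])
  have lap: "?L $$ (a, b) = of_real (z v) * d
      - (\<Sum>e | e \<in> arcs G \<and> tail G e = v. of_real (x e) * (U e *\<^sub>v f (head G e)) $ i)"
  proof -
    have car: "twisted_laplacian G n x U f u \<in> carrier_vec (n u)" for u
      unfolding twisted_laplacian_def by (rule finsum_vec_closed[OF finsum_laplacian_carrier[OF f]])
    have "?L $$ (a, b) = flatten p (twisted_laplacian G n x U f) $ a"
      unfolding endo_mat_def Let_def len using a b by (simp add: mat_of_cols_index f_def)
    also have "\<dots> = twisted_laplacian G n x U f v $ i"
      unfolding flatten_def av block_offset_def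
      by (rule flatten_upt(2)[where n = n and v = v and i = i, OF car v' i])
    finally show ?thesis using twisted_laplacian_index[OF f i, of x] by (simp add: fvi z_def)
  qed
  have transfer: "transfer_mat $$ (a, b) = (\<Sum>e | e \<in> arcs G \<and> tail G e = v.
      of_real (q e) * (U e *\<^sub>v f (head G e)) $ i)"
  proof -
    have "transfer_mat $$ (a, b) = (transfer_mat *\<^sub>v unit_vec N b) $ a"
      using a b by (simp add: transfer_mat_def)
    also have "\<dots> = (block_proj v *\<^sub>v (transfer_mat *\<^sub>v unit_vec N b)) $ i"
      unfolding av
      by (rule block_proj_mult_vec[OF v i mult_mat_vec_carrier[OF transfer_mat_carrier unit_vec_carrier],
            symmetric])
    also have "\<dots> = (\<Sum>e | e \<in> arcs G \<and> tail G e = v.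
        ((of_real (q e) \<cdot>\<^sub>m U e) *\<^sub>v (block_proj (head G e) *\<^sub>v unit_vec N b)) $ i)"
      unfolding transfer_mat_mult_vec_block[OF unit_vec_carrier v] using i by simp
    also have "\<dots> = (\<Sum>e | e \<in> arcs G \<and> tail G e = v. of_real (q e) * (U e *\<^sub>v f (head G e)) $ i)"
    proof (rule sum.cong[OF refl])
      fix e assume "e \<in> {e. e \<in> arcs G \<and> tail G e = v}"
      then have e: "e \<in> arcs G" "U e \<in> carrier_mat (n v) (n (head G e))" using U_carrier[of e] by auto
      have "dim_row (U e) = n v" "dim_col (U e) = n (head G e)" "dim_vec (f (head G e)) = n (head G e)"
        using e f[of "head G e"] by auto
      then show "((of_real (q e) \<cdot>\<^sub>m U e) *\<^sub>v (block_proj (head G e) *\<^sub>v unit_vec N b)) $ i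
          = of_real (q e) * (U e *\<^sub>v f (head G e)) $ i"
        using i e(1) by (simp add: f_eq)
    qed
    finally show ?thesis .
  qed
  have "(?D * ?M) $$ (a, b) = (\<Sum>k<N. ?D $$ (a, k) * ?M $$ (k, b))"
    by (rule index_mult_mat_sum[OF D M a b])
  also have "\<dots> = (\<Sum>k<N. if k = a then of_real (z v + \<kappa> v) * ?M $$ (k, b) else 0)"
  proof (rule sum.cong[OF refl])
    fix k assume "k \<in> {..<N}"
    then have "k < N" by simp
    then show "?D $$ (a, k) * ?M $$ (k, b) = (if k = a then of_real (z v + \<kappa> v) * ?M $$ (k, b) else 0)"
      by (subst diag) simp_all
  qed
  also have "\<dots> = of_real (z v + \<kappa> v) * ?M $$ (a, b)" using a by simp
  also have "?M $$ (a, b) = d - transfer_mat $$ (a, b)"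
    using a b by (simp add: transfer_mat_def d_def)
  also have "of_real (z v + \<kappa> v) * (d - transfer_mat $$ (a, b))
      = of_real (z v + \<kappa> v) * d
        - (\<Sum>e | e \<in> arcs G \<and> tail G e = v. of_real ((z v + \<kappa> v) * q e) * (U e *\<^sub>v f (head G e)) $ i)"
    by (simp add: transfer right_diff_distrib sum_distrib_left mult.assoc)
  also have "(\<Sum>e | e \<in> arcs G \<and> tail G e = v. of_real ((z v + \<kappa> v) * q e) * (U e *\<^sub>v f (head G e)) $ i)
      = (\<Sum>e | e \<in> arcs G \<and> tail G e = v. of_real (x e) * (U e *\<^sub>v f (head G e)) $ i)"
  proof (rule sum.cong[OF refl])
    fix e assume "e \<in> {e. e \<in> arcs G \<and> tail G e = v}"
    then have "(z v + \<kappa> v) * q e = x e" using q[of e] by auto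
    then show "of_real ((z v + \<kappa> v) * q e) * (U e *\<^sub>v f (head G e)) $ i
        = of_real (x e) * (U e *\<^sub>v f (head G e)) $ i"
      by (simp only:)
  qed
  also have "of_real (z v + \<kappa> v) * d
      - (\<Sum>e | e \<in> arcs G \<and> tail G e = v. of_real (x e) * (U e *\<^sub>v f (head G e)) $ i)
      = ?K $$ (a, b) + ?L $$ (a, b)"
    unfolding diag[OF b] lap by (simp add: d_def algebra_simps)
  also have "\<dots> = (?K + ?L) $$ (a, b)"
    by (rule index_add_mat(1)[symmetric]) (simp_all only: carrier_matD[OF L] a b)
  finally show "(?K + ?L) $$ (a, b) = (?D * ?M) $$ (a, b)" by (rule sym)
qed

end

theorem theorem1p8:
  fixes G :: "(nat, 'e) pre_digraph" and p :: nat and n :: "nat \<Rightarrow> nat"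
    and x :: "'e \<Rightarrow> real" and \<kappa> :: "nat \<Rightarrow> real" and U :: "'e \<Rightarrow> complex mat"
  assumes "fin_digraph G" and "loopfree_digraph G" and "verts G = {1..p}"
    and "\<forall>v\<in>verts G. n v \<ge> 1"
    and "\<forall>e\<in>arcs G. x e \<ge> 0"
    and "\<forall>a\<in>verts G. \<kappa> a \<ge> 0"
    and "\<forall>e\<in>arcs G. U e \<in> carrier_mat (n (tail G e)) (n (head G e))"
    and "\<forall>a\<in>verts G. \<exists>b\<in>verts G. \<kappa> b > 0 \<and>
           (\<exists>es. pre_digraph.awalk G a es b \<and> (\<forall>e\<in>set es. x e > 0))"
    and "\<exists>N. (\<forall>v\<in>verts G. vec_norm_on (n v) (N v)) \<and>
           (\<forall>e\<in>arcs G. op_norm (n (head G e)) (N (head G e)) (N (tail G e)) (U e) \<le> 1)"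
  shows "abs_convergent_prod_on (cycle_factor G n (trans_prob G x \<kappa>) U) (prime_cycles G) \<and>
    det (diag_block_mat (map (\<lambda>a. complex_of_real (\<kappa> a) \<cdot>\<^sub>m 1\<^sub>m (n a)) [1..<Suc p])
         + endo_mat n p (twisted_laplacian G n x U))
    = complex_of_real (\<Prod>a\<in>verts G. (out_weight G x a + \<kappa> a) ^ n a)
      * infprod (cycle_factor G n (trans_prob G x \<kappa>) U) (prime_cycles G)"
proof -
  interpret fin_digraph G by fact
  note x_nonneg = bspec[OF assms(5)] and \<kappa>_nonneg = bspec[OF assms(6)] and U = bspec[OF assms(7)]
  obtain \<nu> where norms: "\<And>v. v \<in> verts G \<Longrightarrow> vec_norm_on (n v) (\<nu> v)"
    and op: "\<And>e. e \<in> arcs G \<Longrightarrow> op_norm (n (head G e)) (\<nu> (head G e)) (\<nu> (tail G e)) (U e) \<le> 1"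
    using assms(9) by blast
  define q where "q = trans_prob G x \<kappa>"
  define c where "c v = out_weight G x v + \<kappa> v" for v
  have out_nonneg: "0 \<le> out_weight G x v" for v
    unfolding out_weight_def using x_nonneg by (intro sum_nonneg) auto
  \<comment> \<open>Either \<open>v\<close> itself is a vertex with \<open>\<kappa> v > 0\<close>, or an arc of positive weight leaves it.\<close>
  have c_pos: "0 < c v" if v: "v \<in> verts G" for v
  proof -
    obtain b es where b: "b \<in> verts G" "0 < \<kappa> b" and es: "awalk v es b" "\<forall>e\<in>set es. 0 < x e"
      using assms(8) v by blast
    show ?thesis
    proof (cases es)
      case Nil
      then show ?thesis using es b out_nonneg[of v] by (simp add: c_def awalk_Nil_iff)
    next
      case (Cons e es')
      then have e: "e \<in> arcs G" "tail G e = v" "0 < x e" using es by (auto simp: awalk_Cons_iff)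
      have "x e \<le> out_weight G x v"
        unfolding out_weight_def using e x_nonneg by (intro member_le_sum) auto
      then show ?thesis using e(3) \<kappa>_nonneg[OF v] by (simp add: c_def)
    qed
  qed
  have q_eq: "q e = x e / c (tail G e)" for e by (simp add: q_def trans_prob_def c_def)
  have sum_q: "(\<Sum>e | e \<in> arcs G \<and> tail G e = v. q e) = out_weight G x v / c v" for v
    by (simp add: q_eq out_weight_def sum_divide_distrib)
  interpret contractive_quiver G p n q U \<nu>
  proof unfold_locales
    show "verts G = {1..p}" by fact
    show "U e \<in> carrier_mat (n (tail G e)) (n (head G e))" if "e \<in> arcs G" for e
      using U[OF that] .
    show "0 \<le> q e" if "e \<in> arcs G" for e
      using x_nonneg[OF that] c_pos[of "tail G e"] that by (simp add: q_eq)
    show "(\<Sum>e | e \<in> arcs G \<and> tail G e = v. q e) \<le> 1" if "v \<in> verts G" for v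
      using c_pos[OF that] \<kappa>_nonneg[OF that] by (simp add: sum_q c_def)
    show "\<exists>b\<in>verts G. (\<Sum>e | e \<in> arcs G \<and> tail G e = b. q e) < 1 \<and>
        (\<exists>es. awalk v es b \<and> (\<forall>e\<in>set es. 0 < q e))" if v: "v \<in> verts G" for v
    proof -
      obtain b es where b: "b \<in> verts G" "0 < \<kappa> b" and es: "awalk v es b" "\<forall>e\<in>set es. 0 < x e"
        using assms(8) v by blast
      have "0 < q e" if "e \<in> set es" for e
      proof -
        have "e \<in> arcs G" using es(1) that by (auto simp: awalk_def)
        then show ?thesis using es(2) that c_pos[of "tail G e"] by (simp add: q_eq)
      qed
      moreover have "(\<Sum>e | e \<in> arcs G \<and> tail G e = b. q e) < 1"
        using c_pos[OF b(1)] b(2) by (simp add: sum_q c_def)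
      ultimately show ?thesis using b(1) es(1) by blast
    qed
    show "vec_norm_on (n v) (\<nu> v)" if "v \<in> verts G" for v using norms[OF that] .
    show "\<nu> (tail G e) (U e *\<^sub>v u) \<le> \<nu> (head G e) u"
      if e: "e \<in> arcs G" and u: "u \<in> carrier_vec (n (head G e))" for e u
      using op_norm_le_1_contracts[OF norms norms U[OF e] op[OF e] u] e by simp
  qed
  let ?D = "diag_block_mat (map (\<lambda>a. complex_of_real (c a) \<cdot>\<^sub>m 1\<^sub>m (n a)) [1..<Suc p])"
  have N_eq: "N = (\<Sum>u\<in>{1..<Suc p}. n u)" by (simp add: N_def block_offset_def)
  have D: "?D \<in> carrier_mat N N" unfolding N_eq by (rule diag_block_scalar_upt(1))
  have "det (diag_block_mat (map (\<lambda>a. complex_of_real (\<kappa> a) \<cdot>\<^sub>m 1\<^sub>m (n a)) [1..<Suc p])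
         + endo_mat n p (twisted_laplacian G n x U)) = det (?D * (1\<^sub>m N - transfer_mat))"
    unfolding c_def
  proof (rule arg_cong[OF laplacian_matrix])
    fix e assume "e \<in> arcs G"
    then have "0 < c (tail G e)" by (intro c_pos) simp
    then show "(out_weight G x (tail G e) + \<kappa> (tail G e)) * q e = x e"
      by (simp add: q_eq c_def)
  qed
  also have "\<dots> = det ?D * det (1\<^sub>m N - transfer_mat)"
    by (rule det_mult[OF D minus_carrier_mat[OF transfer_mat_carrier]])
  also have "det ?D = (\<Prod>u\<in>{1..<Suc p}. of_real (c u) ^ n u)"
    by (rule diag_block_scalar_upt(2))
  also have "\<dots> = of_real (\<Prod>a\<in>verts G. (out_weight G x a + \<kappa> a) ^ n a)"
    unfolding assms(3) by (simp add: c_def atLeastLessThanSuc_atLeastAtMost)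
  finally show ?thesis
    using det_one_minus_transfer_mat by (simp add: q_def)
qed

end
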